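(* Let $p$ be an odd prime, $m$ a positive integer, $n=2m$, let $s,r$ be integers with $\gcd(s,p^m+1)=1$ and $r$ a positive divisor of $p^m+1$, and let $a\in\mathbb{F}_{p^n}^*$, $b\in\mathbb{F}_p^*$. Define $f:\mathbb{F}_{p^n}\to\mathbb{F}_p$ by $f(0)=0$ and $$f(x)=\sum_{i=1}^{\frac{p^m+1}{r}-1}{\rm Tr}_1^n\big(ax^{(ri+s)(p^m-1)}\big)+bx^{\frac{p^n-1}{2}}.$$ Then $f$ is regular bent if and only if $$\big(1-K_m(a^{p^m+1})\big)\cos\frac{2\pi b}{p}=\begin{cases}4I\sin\frac{2\pi b}{p}\sin\frac{2\pi Q(-a)}{p}+\epsilon,& -a\in\mathcal{C}_0^+;\\ \epsilon,&\text{otherwise,}\end{cases}$$ where $$\epsilon=\sum_{x\in U,\,x^r=1}\omega^{{\rm Tr}_1^n(-ax^s)+bx^{\frac{p^m+1}{2}}}-\sum_{x\in U,\,x^r=1}\omega^{(\frac{p^m+1}{r}-1){\rm Tr}_1^n(ax^s)+bx^{\frac{p^m+1}{2}}}+1.$$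
   Context: $\omega=e^{2\pi\sqrt{-1}/p}$. ${\rm Tr}_k^t$ is the trace map from $\mathbb{F}_{p^t}$ to $\mathbb{F}_{p^k}$. $U=\{x\in\mathbb{F}_{p^n}:x^{p^m+1}=1\}$. $K_m(\beta)=\sum_{x\in\mathbb{F}_{p^m}}\omega^{{\rm Tr}_1^m(\beta x+x^{p^m-2})}$. $\mathcal{C}_0$ is the set of nonzero squares of $\mathbb{F}_{p^n}$; for $c\in\mathcal{C}_0$, $Q(c)=2{\rm Tr}_1^m\big(c^{\frac{p^m+1}{2}}\big)$, and $\mathcal{C}_0^+=\{c\in\mathcal{C}_0:Q(c)\ne0\}$. $I=\frac{(-1)^{3m/2}p^{m/2}}{2}$ if $p\equiv 3\pmod 4$ and $I=\frac{(-1)^m p^{m/2}}{2}$ otherwise, with $(-1)^{3m/2}=e^{3m\pi\sqrt{-1}/2}$. For $f:\mathbb{F}_{p^n}\to\mathbb{F}_p$, $W_f(\lambda)=\sum_{x}\omega^{f(x)-{\rm Tr}_1^n(\lambda x)}$; $f$ is regular bent if for every $\lambda$, $W_f(\lambda)=p^{n/2}\omega^{f^*(\lambda)}$ for some function $f^*:\mathbb{F}_{p^n}\to\mathbb{F}_p$. *)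

theory Defs
  imports "HOL-Analysis.Analysis"
begin

text \<open>The field F_{p^n} is modelled by a finite field type 'a with CARD('a) = p^n.
  Subfields F_{p^k} are the sets of fixed points of x \<mapsto> x^(p^k).\<close>

definition subfield_pk :: "nat \<Rightarrow> nat \<Rightarrow> ('a::field) set" where
  "subfield_pk p k = {x. x ^ (p ^ k) = x}"

definition trace1 :: "nat \<Rightarrow> nat \<Rightarrow> 'a::field \<Rightarrow> 'a" where
  "trace1 p d x = (\<Sum>i<d. x ^ (p ^ i))"

definition fp_rep :: "nat \<Rightarrow> 'a::field \<Rightarrow> nat" where
  "fp_rep p t = (THE k. k < p \<and> of_nat k = t)"

definition omega_pow :: "nat \<Rightarrow> 'a::field \<Rightarrow> complex" where
  "omega_pow p t = cis (2 * pi * real (fp_rep p t) / real p)"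

definition kloost :: "nat \<Rightarrow> nat \<Rightarrow> 'a::{finite,field} \<Rightarrow> complex" where
  "kloost p m \<beta> = (\<Sum>x\<in>subfield_pk p m. omega_pow p (trace1 p m (\<beta> * x + x ^ (p ^ m - 2))))"

definition unit_circle :: "nat \<Rightarrow> nat \<Rightarrow> ('a::field) set" where
  "unit_circle p m = {x. x ^ (p ^ m + 1) = 1}"

definition nz_squares :: "('a::field) set" where
  "nz_squares = {c. c \<noteq> 0 \<and> (\<exists>d. c = d ^ 2)}"

definition Qf :: "nat \<Rightarrow> nat \<Rightarrow> 'a::field \<Rightarrow> 'a" where
  "Qf p m c = 2 * trace1 p m (c ^ ((p ^ m + 1) div 2))"

definition C0_plus :: "nat \<Rightarrow> nat \<Rightarrow> ('a::field) set" where
  "C0_plus p m = {c \<in> nz_squares. Qf p m c \<noteq> 0}"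

definition I_const :: "nat \<Rightarrow> nat \<Rightarrow> complex" where
  "I_const p m = (if p mod 4 = 3
     then exp (complex_of_real (3 * real m * pi / 2) * \<i>) * complex_of_real (real p powr (real m / 2)) / 2
     else (-1) ^ m * complex_of_real (real p powr (real m / 2)) / 2)"

definition walsh :: "nat \<Rightarrow> nat \<Rightarrow> ('a::{finite,field} \<Rightarrow> 'a) \<Rightarrow> 'a \<Rightarrow> complex" where
  "walsh p n f lam = (\<Sum>x\<in>UNIV. omega_pow p (f x - trace1 p n (lam * x)))"

definition regular_bent :: "nat \<Rightarrow> nat \<Rightarrow> ('a::{finite,field} \<Rightarrow> 'a) \<Rightarrow> bool" where
  "regular_bent p n f = (\<exists>fs :: 'a \<Rightarrow> 'a. (\<forall>lam. fs lam \<in> subfield_pk p 1) \<and>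
      (\<forall>lam. walsh p n f lam = complex_of_real (real p powr (real n / 2)) * omega_pow p (fs lam)))"

end

(* For x \<noteq> 0 the value f x depends only on u = x^(p^m - 1), which lies on the unit circle U.  Summing
   over the cosets of the multiplicative group of K = F_{p^m} gives W_f(0) = 1 + (p^m - 1) S and
   W_f(\<lambda>) = 1 - S + p^m \<omega>^{g(u)}, where g(x^(p^m - 1)) = f x and S = \<Sum>_{u \<in> U} \<omega>^{g(u)}.  So f is
   regular bent iff S = 1; the converse direction holds because 1 - \<omega>^i = (p^m - 1)(\<omega>^j - \<omega>^k)
   forces \<omega>^i = 1 by comparing absolute values.  A geometric sum in u^r gives S = T - \<epsilon> + 1 with
   T = \<Sum>_{u \<in> U} \<omega>^{Tr(-a u) + b u^((p^m+1)/2)}, the exponent s being absorbed by a permutation of U.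
   Splitting T by the sign u^((p^m+1)/2) = \<plusminus> 1, the even part is 1 - K_m(a^(p^m+1)), since the norm
   fibre and the graph of z + \<beta>/z together hit every trace twice.  The odd part vanishes unless -a is
   a square, and is then \<plusminus> the quadratic Gauss sum of K times 2i sin(2 \<pi> Q(-a) / p).

   The Gauss sum is needed with its sign.  Over F_p, Gauss's evaluation of the alternating sum of
   q-binomial coefficients at a root of unity turns it into a product of sines.  Over K, an
   orthogonal basis of the trace form reduces it to F_p up to the quadratic character of the
   discriminant, which is (-1)^(m-1). *)

theory Submission
  imports Defs "HOL-Computational_Algebra.Computational_Algebra" "HOL-Number_Theory.Cong"
    "HOL-Library.Real_Mod" "Jordan_Normal_Form.Determinant"
begin

section \<open>Finite fields of odd characteristic and their subfields\<close>

text \<open>Otherwise the simplifier turns the index of the prime field \<open>subfield_pk p 1\<close> into \<open>Suc 0\<close>.\<close>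
declare One_nat_def [simp del]

locale odd_finite_field =
  fixes p n :: nat and field_type :: "'a::{finite,field} itself"
  assumes prime_p: "prime p" and odd_p: "odd p" and card_field: "CARD('a) = p ^ n"
begin

lemma p_ge_3: "p \<ge> 3"
  using prime_p odd_p by (metis One_nat_def Suc_leI le_neq_implies_less numeral_2_eq_2 numeral_3_eq_3 prime_ge_2_nat even_numeral)

lemma n_pos: "n > 0"
proof (rule ccontr)
  assume "\<not> n > 0"
  hence "CARD('a) = 1" using card_field by simp
  then obtain x :: 'a where "UNIV = {x}" by (rule card_1_singletonE)
  thus False by (metis UNIV_I singletonD zero_neq_one)
qed

text \<open>Translation by 1 permutes the field, so the sum of all elements is unchanged while
  growing by \<open>CARD('a)\<close> copies of 1. Hence \<open>p ^ n\<close>, and with it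
  \<open>p\<close>, is zero in the field.\<close>

lemma of_nat_p: "of_nat p = (0::'a)"
proof -
  have "(\<Sum>x\<in>UNIV. x) = (\<Sum>x\<in>UNIV. x + (1::'a))"
    by (rule sum.reindex_bij_witness[of _ "\<lambda>x. x + 1" "\<lambda>x. x - 1"]) auto
  hence "of_nat CARD('a) = (0::'a)" by (simp add: sum.distrib)
  thus ?thesis using card_field by (simp add: n_pos)
qed

lemma CHAR_eq: "CHAR('a) = p"
proof -
  have "CHAR('a) dvd p" using of_nat_p by (simp add: of_nat_eq_0_iff_char_dvd)
  thus ?thesis using prime_p by (metis CHAR_not_1' One_nat_def prime_nat_iff)
qed

lemma frob_add: "((x::'a) + y) ^ (p ^ i) = x ^ (p ^ i) + y ^ (p ^ i)"
  by (rule freshmans_dream') (auto simp: CHAR_eq prime_p)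

lemma frob_minus: "(- (x::'a)) ^ (p ^ i) = - (x ^ (p ^ i))"
  using odd_p by (simp add: power_minus_odd)

lemma frob_diff: "((x::'a) - y) ^ (p ^ i) = x ^ (p ^ i) - y ^ (p ^ i)"
  using frob_add[of x "- y" i] by (simp add: frob_minus)

lemma frob_sum: "(\<Sum>j\<in>A. g j :: 'a) ^ (p ^ i) = (\<Sum>j\<in>A. g j ^ (p ^ i))"
  by (rule freshmans_dream_sum') (auto simp: CHAR_eq prime_p)

text \<open>Multiplication by \<open>x\<close> permutes the nonzero elements, so their product
  absorbs the factor \<open>x ^ (p ^ n - 1)\<close>.\<close>

lemma power_card_minus_1:
  assumes "(x::'a) \<noteq> 0" shows "x ^ (p ^ n - 1) = 1"
proof -
  have "(\<Prod>y\<in>UNIV-{0}. x * y) = (\<Prod>y\<in>UNIV-{0}. y)"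
    by (rule prod.reindex_bij_witness[of _ "\<lambda>y. y / x" "\<lambda>y. x * y"]) (use assms in auto)
  moreover have "(\<Prod>y\<in>UNIV-{0}. x * y) = x ^ (p ^ n - 1) * (\<Prod>y\<in>UNIV-{0}. y)"
    by (simp add: prod.distrib card_field)
  moreover have "(\<Prod>y\<in>UNIV-{0::'a}. y) \<noteq> 0" by simp
  ultimately show ?thesis by simp
qed

lemma power_card: "(x::'a) ^ (p ^ n) = x"
proof (cases "x = 0")
  case False
  have "x ^ (p ^ n) = x ^ (p ^ n - 1) * x"
    using prime_p by (simp add: prime_gt_0_nat flip: power_Suc2)
  also have "\<dots> = x" using power_card_minus_1[OF False] by simp
  finally show ?thesis .
qed (use prime_p in \<open>simp add: prime_gt_0_nat\<close>)

lemma two_neq_0: "(2::'a) \<noteq> 0"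
proof
  assume "(2::'a) = 0"
  hence "of_nat 2 = (0::'a)" by simp
  hence "p dvd 2" using CHAR_eq of_nat_eq_0_iff_char_dvd by metis
  thus False using p_ge_3 by (auto dest: dvd_imp_le)
qed

lemma four_neq_0: "(4::'a) \<noteq> 0"
  using two_neq_0 by (metis mult_2 no_zero_divisors numeral_Bit0)

lemma one_neq_minus_1: "(1::'a) \<noteq> -1"
  using two_neq_0 by (metis add_eq_0_iff one_add_one)

lemma neg_neq: "(x::'a) \<noteq> 0 \<Longrightarrow> x \<noteq> - x"
  using two_neq_0 by (metis add_eq_0_iff mult_2 no_zero_divisors)

lemma card_roots_le:
  assumes "d > 0" shows "card {x::'a. x ^ d = y} \<le> d"
proof -
  let ?P = "monom 1 d - [:y:]"
  have deg: "degree ?P = d" using assms by (simp add: degree_monom_eq degree_add_eq_left diff_conv_add_uminus del: add_uminus_conv_diff)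
  hence "?P \<noteq> 0" using assms by auto
  from card_poly_roots_bound[OF this] show ?thesis by (simp add: deg poly_monom)
qed

text \<open>A double count proves both claims at once. The \<open>e\<close>-th power map sends the
  \<open>d * e\<close> nonzero elements into the \<open>d\<close>-th roots of unity with fibres of
  size at most \<open>e\<close>, so its image has at least \<open>d\<close> elements. There are at
  most \<open>d\<close> such roots, hence equality throughout.\<close>

lemma
  assumes de: "d * e = p ^ n - 1"
  shows card_roots_unity: "card {x::'a. x ^ d = 1} = d"
    and roots_unity_power: "(x::'a) ^ d = 1 \<Longrightarrow> \<exists>y. y \<noteq> 0 \<and> x = y ^ e"
proof -
  have "p ^ n > 1" using p_ge_3 n_pos by (intro one_less_power) auto
  hence pos: "d > 0" "e > 0" using de by (auto intro!: gr0I)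
  let ?R = "{x::'a. x ^ d = 1}" and ?I = "(\<lambda>y. y ^ e) ` (UNIV - {0::'a})"
  have sub: "?I \<subseteq> ?R"
    using power_card_minus_1 by (auto simp: de mult.commute simp flip: power_mult)
  have "d * e = card (\<Union>x\<in>?I. {y. y ^ e = x} - {0::'a})"
  proof -
    have "(\<Union>x\<in>?I. {y. y ^ e = x} - {0::'a}) = UNIV - {0}" by auto
    thus ?thesis by (simp add: de card_field)
  qed
  also have "\<dots> \<le> (\<Sum>x\<in>?I. card ({y. y ^ e = x} - {0::'a}))" by (rule card_UN_le) simp
  also have "\<dots> \<le> (\<Sum>x\<in>?I. e)"
    by (intro sum_mono order.trans[OF card_mono card_roots_le[OF pos(2)]]) auto
  finally have "d * e \<le> card ?I * e" by simp
  hence "d \<le> card ?I" using pos by simp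
  moreover have "card ?I \<le> card ?R" using sub by (intro card_mono) auto
  moreover have "card ?R \<le> d" by (rule card_roots_le[OF pos(1)])
  ultimately have "card ?I = card ?R" "card ?R = d" by auto
  thus "card ?R = d" by simp
  have "?I = ?R" using sub \<open>card ?I = card ?R\<close> by (intro card_subset_eq) auto
  thus "x ^ d = 1 \<Longrightarrow> \<exists>y. y \<noteq> 0 \<and> x = y ^ e" by blast
qed

lemma square_if_power_half:
  assumes "(x::'a) ^ ((p ^ n - 1) div 2) = 1" shows "\<exists>y. y \<noteq> 0 \<and> x = y\<^sup>2"
  by (rule roots_unity_power[of "(p ^ n - 1) div 2" 2]) (use assms odd_p in auto)

end

section \<open>Subfields as fixed points of a power of Frobenius\<close>

locale odd_finite_subfield = odd_finite_field p n field_type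
  for p n :: nat and field_type :: "'a::{finite,field} itself" +
  fixes k :: nat
  assumes k_dvd: "k dvd n"
begin

abbreviation "q \<equiv> p ^ k"
abbreviation "K \<equiv> subfield_pk p k :: 'a set"

lemma k_pos: "k > 0"
  using k_dvd n_pos by (auto intro!: gr0I)

lemma q_ge_3: "q \<ge> 3"
  using p_ge_3 k_pos self_le_power[of p k] by linarith

lemma odd_q: "odd q" using odd_p by simp

lemma q_minus_1_dvd: "q - 1 dvd p ^ n - 1"
proof -
  obtain l where "n = k * l" using k_dvd by blast
  hence "int (p ^ n - 1) = int q ^ l - 1" using p_ge_3 by (simp add: of_nat_diff power_mult)
  also have "int q - 1 dvd \<dots>" using power_diff_1_eq[of "int q" l] by simp
  finally have "int (q - 1) dvd int (p ^ n - 1)" using p_ge_3 by (simp add: of_nat_diff)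
  thus ?thesis by (simp only: int_dvd_int_iff)
qed

lemma K_iff: "x \<in> K \<longleftrightarrow> x = 0 \<or> x ^ (q - 1) = 1"
proof (cases "x = 0")
  case False
  have "x ^ q = x ^ (q - 1) * x" by (rule power_minus_mult[symmetric]) (use q_ge_3 in linarith)
  thus ?thesis using False by (simp add: subfield_pk_def)
qed (use p_ge_3 in \<open>simp add: subfield_pk_def\<close>)

lemma K_power: "x \<in> K \<Longrightarrow> x ^ q = x" by (simp add: subfield_pk_def)

lemma K_closed [intro]:
  "(0::'a) \<in> K" "(1::'a) \<in> K"
  "x \<in> K \<Longrightarrow> y \<in> K \<Longrightarrow> x + y \<in> K" "x \<in> K \<Longrightarrow> y \<in> K \<Longrightarrow> x - y \<in> K"
  "x \<in> K \<Longrightarrow> y \<in> K \<Longrightarrow> x * y \<in> K" "x \<in> K \<Longrightarrow> y \<in> K \<Longrightarrow> x / y \<in> K"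
  "x \<in> K \<Longrightarrow> - x \<in> K"
  using p_ge_3
  by (simp_all add: subfield_pk_def frob_add frob_diff frob_minus power_mult_distrib power_divide)

lemma K_closed_power [intro]: "x \<in> K \<Longrightarrow> x ^ i \<in> K"
  by (induction i) auto

lemma K_sum [intro]: "(\<And>j. j \<in> A \<Longrightarrow> g j \<in> K) \<Longrightarrow> (\<Sum>j\<in>A. g j) \<in> K"
  by (induction A rule: infinite_finite_induct) auto

lemma K_numeral [intro]: "numeral w \<in> K"
  by (induction w) (simp_all only: numeral_One numeral_Bit0 numeral_Bit1 K_closed)

lemma card_K: "card K = q"
proof -
  obtain e where e: "p ^ n - 1 = (q - 1) * e" using q_minus_1_dvd by blast
  have "K = insert 0 {x. x ^ (q - 1) = 1}" using K_iff by auto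
  moreover have "0 \<notin> {x::'a. x ^ (q - 1) = 1}" using q_ge_3 by (simp add: power_0_left)
  moreover have "card {x::'a. x ^ (q - 1) = 1} = q - 1" using card_roots_unity e by metis
  ultimately show ?thesis using q_ge_3 by simp
qed

end

section \<open>Additive and quadratic characters, Gauss sums\<close>

context odd_finite_field
begin

text \<open>Taking \<open>k = 1\<close> gives the prime field. Traces, characters and Gauss sums are
  thereby developed once for every subfield and compared across levels later.\<close>

sublocale prime: odd_finite_subfield p n field_type 1
  by unfold_locales simp

abbreviation "Fp \<equiv> subfield_pk p 1 :: 'a set"

lemma of_nat_Fp [simp, intro]: "(of_nat i :: 'a) \<in> Fp"
  by (induction i) (auto intro: prime.K_closed)

lemma of_nat_eq_iff: "(of_nat i :: 'a) = of_nat j \<longleftrightarrow> [i = j] (mod p)"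
  using of_nat_eq_iff_cong_CHAR[of i j, where ?'a = 'a] by (simp add: CHAR_eq)

lemma bij_of_nat_Fp: "bij_betw of_nat {..<p} Fp"
proof -
  have inj: "inj_on (of_nat :: nat \<Rightarrow> 'a) {..<p}"
    by (auto simp: inj_on_def of_nat_eq_iff cong_def)
  moreover have "of_nat ` {..<p} = Fp"
    using prime.card_K by (intro card_subset_eq) (auto simp: card_image[OF inj])
  ultimately show ?thesis by (simp add: bij_betw_def)
qed

lemma Fp_E:
  assumes "x \<in> Fp" obtains i where "i < p" "x = of_nat i"
  using assms bij_of_nat_Fp by (auto simp: bij_betw_def)

lemma fp_rep_of_nat: "fp_rep p (of_nat i :: 'a) = i mod p"
  unfolding fp_rep_def
  by (rule the_equality) (use p_ge_3 in \<open>auto simp: of_nat_eq_iff cong_def\<close>)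

text \<open>Reducing \<open>i\<close> modulo \<open>p\<close> changes the angle by full turns only.
  With arbitrary representatives allowed, additivity of \<open>omega_pow\<close> becomes addition of
  angles.\<close>

lemma omega_pow_of_nat: "omega_pow p (of_nat i :: 'a) = cis (2 * pi * real i / real p)"
proof -
  have "2 * pi * real i / real p = 2 * pi * real (i mod p) / real p + 2 * pi * real (i div p)"
  proof -
    have "real i = real (i mod p) + real p * real (i div p)"
      by (metis mod_mult_div_eq of_nat_add of_nat_mult)
    thus ?thesis using p_ge_3 by (simp add: field_simps)
  qed
  hence "cis (2 * pi * real i / real p) = cis (2 * pi * real (i mod p) / real p) * cis (2 * pi * real (i div p))"
    by (simp only: cis_mult)
  also have "cis (2 * pi * real (i div p)) = 1" by (rule cis_multiple_2pi) simp
  finally show ?thesis by (simp add: omega_pow_def fp_rep_of_nat)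
qed

lemma omega_pow_0 [simp]: "omega_pow p (0::'a) = 1"
  using omega_pow_of_nat[of 0] by simp

lemma omega_pow_add:
  assumes "x \<in> Fp" "y \<in> Fp"
  shows "omega_pow p (x + y) = omega_pow p x * omega_pow p y"
proof -
  obtain i j where "x = of_nat i" "y = of_nat j" using assms by (metis Fp_E)
  thus ?thesis
    by (simp add: omega_pow_of_nat cis_mult add_divide_distrib distrib_left del: of_nat_add flip: of_nat_add)
       (simp add: add_divide_distrib distrib_left)
qed

lemma norm_omega_pow [simp]: "norm (omega_pow p (x::'a)) = 1"
  by (simp add: omega_pow_def)

lemma omega_pow_nonzero [simp]: "omega_pow p (x::'a) \<noteq> 0"
  by (simp add: omega_pow_def)

lemma omega_pow_uminus:
  assumes "x \<in> Fp" shows "omega_pow p (- x) = cnj (omega_pow p x)"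
proof -
  have "omega_pow p (- x) * omega_pow p x = 1"
    using omega_pow_add[of "-x" x] assms by (auto intro: prime.K_closed)
  moreover have "cnj (omega_pow p x) * omega_pow p x = 1"
    by (metis complex_norm_square mult.commute norm_omega_pow of_real_1 one_power2)
  ultimately show ?thesis by (metis mult_right_cancel omega_pow_nonzero)
qed

lemma omega_pow_diff:
  "x \<in> Fp \<Longrightarrow> y \<in> Fp \<Longrightarrow> omega_pow p (x - y) = omega_pow p x * cnj (omega_pow p y)"
  using omega_pow_add[of x "- y"] omega_pow_uminus[of y] by (simp add: prime.K_closed)

lemma omega_pow_sum:
  "(\<And>j. j \<in> A \<Longrightarrow> g j \<in> Fp) \<Longrightarrow> omega_pow p (\<Sum>j\<in>A. g j) = (\<Prod>j\<in>A. omega_pow p (g j))"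
  by (induction A rule: infinite_finite_induct) (auto simp: omega_pow_add prime.K_sum)

lemma omega_pow_eq_1_iff:
  assumes "x \<in> Fp" shows "omega_pow p x = 1 \<longleftrightarrow> x = 0"
proof
  assume *: "omega_pow p x = 1"
  obtain i where i: "i < p" "x = of_nat i" using assms by (rule Fp_E)
  hence "cis (2 * pi * real i / real p) = cis 0" using * by (simp add: omega_pow_of_nat)
  then obtain l :: int where "2 * pi * real i / real p = 2 * pi * of_int l"
    by (auto simp: cis_eq_1_iff)
  hence "real i = real p * of_int l" using p_ge_3 by (simp add: field_simps)
  hence "int i = int p * l" by (metis of_int_eq_iff of_int_mult of_int_of_nat_eq)
  hence "p dvd i" by (metis dvdI int_dvd_int_iff)
  hence "i = 0" using i by (auto dest: dvd_imp_le)
  thus "x = 0" using i by simp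
qed simp

lemma trace1_1 [simp]: "trace1 p 1 (x::'a) = x" "trace1 p (Suc 0) x = x"
  by (simp_all add: trace1_def)

end

context odd_finite_subfield
begin

text \<open>Frobenius shifts the conjugates by one place, and \<open>x ^ q = x\<close> closes the
  cycle.\<close>

lemma trace_Fp:
  assumes "x \<in> K" shows "trace1 p k x \<in> Fp"
proof -
  have "trace1 p k x ^ p = (\<Sum>i<k. x ^ (p ^ Suc i))"
    using frob_sum[of "\<lambda>i. x ^ (p ^ i)" "{..<k}" 1] by (simp add: trace1_def mult.commute flip: power_mult)
  also have "\<dots> = (\<Sum>i<k. x ^ (p ^ i))"
    using sum.lessThan_Suc_shift[of "\<lambda>i. x ^ (p ^ i)" k] sum.lessThan_Suc[of "\<lambda>i. x ^ (p ^ i)" k] assms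
    by (simp add: subfield_pk_def)
  finally show ?thesis by (simp add: subfield_pk_def trace1_def)
qed

lemma trace_add: "trace1 p k ((x::'a) + y) = trace1 p k x + trace1 p k y"
  by (simp add: trace1_def frob_add sum.distrib)

lemma trace_minus: "trace1 p k (- (x::'a)) = - trace1 p k x"
  by (simp add: trace1_def frob_minus sum_negf)

lemma trace_diff: "trace1 p k ((x::'a) - y) = trace1 p k x - trace1 p k y"
  by (simp add: trace1_def frob_diff sum_subtractf)

lemma trace_0 [simp]: "trace1 p k (0::'a) = 0"
  using p_ge_3 by (simp add: trace1_def power_0_left)

lemma trace_sum: "trace1 p k (\<Sum>j\<in>A. g j :: 'a) = (\<Sum>j\<in>A. trace1 p k (g j))"
  by (induction A rule: infinite_finite_induct) (auto simp: trace_add)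

lemma trace_scale: "c \<in> Fp \<Longrightarrow> trace1 p k (c * x) = c * trace1 p k (x::'a)"
proof -
  assume c: "c \<in> Fp"
  have "c ^ (p ^ i) = c" for i
    by (induction i) (use c in \<open>auto simp: subfield_pk_def power_mult\<close>)
  thus ?thesis by (simp add: trace1_def power_mult_distrib sum_distrib_left)
qed

text \<open>The trace is a nonzero polynomial of degree at most \<open>p ^ (k - 1)\<close>, which is
  less than \<open>q\<close>, so it cannot vanish on all of \<open>K\<close>.\<close>

lemma trace_nontrivial: obtains x where "x \<in> K" "trace1 p k x \<noteq> 0"
proof -
  let ?P = "\<Sum>i<k. monom (1::'a) (p ^ i)"
  have "coeff ?P (p ^ j) = (if j < k then 1 else 0)" for j
  proof -
    have "coeff ?P (p ^ j) = (\<Sum>i<k. if i = j then 1 else 0)"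
      unfolding coeff_sum using p_ge_3 by (intro sum.cong) auto
    thus ?thesis by simp
  qed
  from this[of 0] have "?P \<noteq> 0" using k_pos by auto
  hence "card {x. poly ?P x = 0} \<le> degree ?P" by (rule card_poly_roots_bound)
  also have "degree ?P \<le> p ^ (k - 1)"
    using p_ge_3 by (intro degree_sum_le) (auto intro!: order.trans[OF degree_monom_le] power_increasing)
  also have "\<dots> < q" using p_ge_3 k_pos by (intro power_strict_increasing) auto
  finally have "\<not> K \<subseteq> {x. poly ?P x = 0}" using card_K card_mono[of "{x. poly ?P x = 0}" K] by auto
  thus ?thesis using that by (auto simp: poly_sum poly_monom trace1_def)
qed

text \<open>The canonical additive character of \<open>K\<close>. Outside \<open>K\<close> the trace
  need not lie in \<open>Fp\<close>, so the laws below assume membership.\<close>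

definition chi :: "'a \<Rightarrow> complex" where "chi x = omega_pow p (trace1 p k x)"

lemma chi_0 [simp]: "chi 0 = 1" by (simp add: chi_def)

lemma chi_add: "x \<in> K \<Longrightarrow> y \<in> K \<Longrightarrow> chi (x + y) = chi x * chi y"
  by (simp add: chi_def trace_add omega_pow_add trace_Fp)

lemma chi_diff: "x \<in> K \<Longrightarrow> y \<in> K \<Longrightarrow> chi (x - y) = chi x * cnj (chi y)"
  by (simp add: chi_def trace_diff omega_pow_diff trace_Fp)

text \<open>Orthogonality: translating by an element of nonzero trace multiplies the full sum by a
  factor other than 1.\<close>

lemma sum_chi:
  assumes "z \<in> K" shows "(\<Sum>y\<in>K. chi (z * y)) = (if z = 0 then of_nat q else 0)"
proof (cases "z = 0")
  case False
  obtain x where x: "x \<in> K" "trace1 p k x \<noteq> 0" by (rule trace_nontrivial)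
  have "(\<Sum>y\<in>K. chi (z * y)) = (\<Sum>y\<in>K. chi y)"
    by (rule sum.reindex_bij_witness[of _ "\<lambda>y. y / z" "\<lambda>y. z * y"]) (use False assms in auto)
  moreover have "(\<Sum>y\<in>K. chi y) = (\<Sum>y\<in>K. chi (x + y))"
    by (rule sum.reindex_bij_witness[of _ "\<lambda>y. x + y" "\<lambda>y. y - x"]) (use x in auto)
  moreover have "(\<Sum>y\<in>K. chi (x + y)) = chi x * (\<Sum>y\<in>K. chi y)"
    using x by (simp add: chi_add sum_distrib_left)
  moreover have "chi x \<noteq> 1" using x by (simp add: chi_def omega_pow_eq_1_iff trace_Fp)
  ultimately show ?thesis using False by (metis mult_cancel_right1)
qed (simp add: card_K)

text \<open>The quadratic character of \<open>K\<close> in the form of Euler's criterion, which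
  makes multiplicativity immediate. The link to squares follows in \<open>eta_square_nonzero\<close>
  and \<open>eta_eq_1_D\<close>.\<close>

definition eta :: "'a \<Rightarrow> complex" where
  "eta x = (if x = 0 then 0 else if x ^ ((q - 1) div 2) = 1 then 1 else - 1)"

lemma power_half:
  assumes "x \<in> K" "x \<noteq> 0" shows "x ^ ((q - 1) div 2) = 1 \<or> x ^ ((q - 1) div 2) = - 1"
proof -
  have "(x ^ ((q - 1) div 2))\<^sup>2 = x ^ ((q - 1) div 2 * 2)" by (simp add: power_mult)
  also have "(q - 1) div 2 * 2 = q - 1" using odd_q by simp
  also have "x ^ (q - 1) = 1" using assms K_iff by blast
  finally show ?thesis by (simp add: power2_eq_1_iff)
qed

lemma eta_0 [simp]: "eta 0 = 0" by (simp add: eta_def)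
lemma eta_1 [simp]: "eta 1 = 1" by (simp add: eta_def)

lemma eta_eq_1_iff: "x \<noteq> 0 \<Longrightarrow> eta x = 1 \<longleftrightarrow> x ^ ((q - 1) div 2) = 1"
  by (simp add: eta_def)

lemma eta_mult: "x \<in> K \<Longrightarrow> y \<in> K \<Longrightarrow> eta (x * y) = eta x * eta y"
  by (cases "x = 0 \<or> y = 0") (use power_half[of x] power_half[of y] one_neq_minus_1 in
    \<open>auto simp: eta_def power_mult_distrib\<close>)

lemma eta_prod: "(\<And>i. i \<in> A \<Longrightarrow> g i \<in> K) \<Longrightarrow> eta (\<Prod>i\<in>A. g i) = (\<Prod>i\<in>A. eta (g i))"
proof (induction A rule: infinite_finite_induct)
  case (insert i A)
  have "(\<Prod>i\<in>A. g i) \<in> K" using insert.prems by (induction A rule: infinite_finite_induct) auto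
  with insert show ?case by (simp add: eta_mult)
qed auto

lemma eta_cases: "x \<noteq> 0 \<Longrightarrow> eta x = 1 \<or> eta x = - 1"
  by (simp add: eta_def)

lemma eta_square_nonzero: "x \<in> K \<Longrightarrow> x \<noteq> 0 \<Longrightarrow> eta (x\<^sup>2) = 1"
  using eta_cases[of x] by (auto simp: eta_mult power2_eq_square)

text \<open>The square root has to be found inside \<open>K\<close>. With
  \<open>p ^ n - 1 = (q - 1) * e\<close>, the element is a \<open>2 * e\<close>-th power of some
  \<open>y\<close> in the large field, and \<open>y ^ e\<close> lies in \<open>K\<close>.\<close>

lemma eta_eq_1_D:
  assumes "x \<in> K" "eta x = 1" obtains y where "y \<in> K" "y \<noteq> 0" "x = y\<^sup>2"
proof -
  obtain e where e: "p ^ n - 1 = (q - 1) * e" using q_minus_1_dvd by blast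
  have "(q - 1) div 2 * (2 * e) = p ^ n - 1" using odd_q by (simp add: e flip: mult.assoc)
  from roots_unity_power[OF this, of x] assms eta_eq_1_iff[of x] obtain y where "y \<noteq> 0" "x = y ^ (2 * e)"
    by (metis eta_0 zero_neq_one)
  moreover have "(y ^ e) ^ (q - 1) = 1"
    using power_card_minus_1[OF \<open>y \<noteq> 0\<close>] by (simp add: e mult.commute flip: power_mult)
  ultimately show ?thesis using that[of "y ^ e"] K_iff by (simp add: mult.commute flip: power_mult)
qed

lemma card_sqrt:
  assumes "t \<in> K" shows "of_nat (card {x \<in> K. x\<^sup>2 = t}) = 1 + eta t"
proof -
  consider "t = 0" | "t \<noteq> 0" "eta t = 1" | "t \<noteq> 0" "eta t = -1" using eta_cases[of t] by blast
  thus ?thesis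
  proof cases
    case 1
    hence "{x \<in> K. x\<^sup>2 = t} = {0}" by auto
    thus ?thesis using 1 by simp
  next
    case 2
    then obtain y where y: "y \<in> K" "y \<noteq> 0" "t = y\<^sup>2" using assms eta_eq_1_D by metis
    hence "{x \<in> K. x\<^sup>2 = t} = {y, - y}" by (auto simp: power2_eq_iff)
    thus ?thesis using 2 neg_neq[OF y(2)] by simp
  next
    case 3
    have "x \<in> K \<Longrightarrow> x\<^sup>2 \<noteq> t" for x using 3 eta_square_nonzero[of x] by auto
    hence "{x \<in> K. x\<^sup>2 = t} = {}" by auto
    thus ?thesis using 3 by simp
  qed
qed

text \<open>The quadratic Gauss sum of \<open>K\<close>.\<close>

definition gauss :: complex where "gauss = (\<Sum>t\<in>K. eta t * chi t)"

lemma gauss_twist: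
  assumes "z \<in> K" "z \<noteq> 0" shows "(\<Sum>t\<in>K. eta t * chi (z * t)) = eta z * gauss"
proof -
  have "eta z * (\<Sum>t\<in>K. eta t * chi (z * t)) = (\<Sum>t\<in>K. eta (z * t) * chi (z * t))"
    using assms by (simp add: eta_mult sum_distrib_left mult_ac)
  also have "\<dots> = gauss" unfolding gauss_def
    by (rule sum.reindex_bij_witness[of _ "\<lambda>y. y / z" "\<lambda>y. z * y"]) (use assms in auto)
  finally have "eta z * eta z * (\<Sum>t\<in>K. eta t * chi (z * t)) = eta z * gauss" by (simp add: mult.assoc)
  moreover have "eta z * eta z = 1" using assms by (simp add: eta_def)
  ultimately show ?thesis by simp
qed

text \<open>Grouping by the value \<open>t\<close> of the square weights \<open>t\<close> with
  \<open>1 + eta t\<close>. The constant part sums to zero by orthogonality.\<close>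

lemma sum_chi_square:
  assumes "z \<in> K" "z \<noteq> 0" shows "(\<Sum>x\<in>K. chi (z * x\<^sup>2)) = eta z * gauss"
proof -
  have "(\<Sum>x\<in>K. chi (z * x\<^sup>2)) = (\<Sum>t\<in>K. \<Sum>x | x \<in> K \<and> x\<^sup>2 = t. chi (z * x\<^sup>2))"
    by (rule sum.group[symmetric]) auto
  also have "\<dots> = (\<Sum>t\<in>K. of_nat (card {x \<in> K. x\<^sup>2 = t}) * chi (z * t))"
    by (intro sum.cong) auto
  also have "\<dots> = (\<Sum>t\<in>K. (1 + eta t) * chi (z * t))"
    by (intro sum.cong) (simp_all add: card_sqrt)
  also have "\<dots> = (\<Sum>t\<in>K. chi (z * t)) + (\<Sum>t\<in>K. eta t * chi (z * t))"
    by (simp add: ring_distribs sum.distrib)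
  finally show ?thesis using assms by (simp add: sum_chi gauss_twist)
qed

text \<open>In the double sum over squares the substitution \<open>x = h + y\<close> leaves
  \<open>y\<close> in a linear phase only, and summing over \<open>y\<close> kills every
  \<open>h\<close> except 0.\<close>

lemma gauss_mult_cnj: "gauss * cnj gauss = of_nat q"
proof -
  have g: "gauss = (\<Sum>x\<in>K. chi (x\<^sup>2))" using sum_chi_square[of 1] by (simp add: K_closed)
  have "gauss * cnj gauss = (\<Sum>y\<in>K. \<Sum>x\<in>K. chi (x\<^sup>2) * cnj (chi (y\<^sup>2)))"
    unfolding g cnj_sum sum_product by (rule sum.swap)
  also have "\<dots> = (\<Sum>y\<in>K. \<Sum>h\<in>K. chi (h\<^sup>2) * chi (2 * h * y))"
  proof (rule sum.cong[OF refl])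
    fix y assume y: "y \<in> K"
    have "(\<Sum>x\<in>K. chi (x\<^sup>2) * cnj (chi (y\<^sup>2))) = (\<Sum>x\<in>K. chi (x\<^sup>2 - y\<^sup>2))"
      using y by (intro sum.cong) (auto simp: chi_diff K_closed_power)
    also have "\<dots> = (\<Sum>h\<in>K. chi (h\<^sup>2 + 2 * h * y))"
      by (rule sum.reindex_bij_witness[of _ "\<lambda>h. h + y" "\<lambda>x. x - y"])
         (use y in \<open>auto simp: power2_eq_square algebra_simps\<close>)
    also have "\<dots> = (\<Sum>h\<in>K. chi (h\<^sup>2) * chi (2 * h * y))"
      using y by (intro sum.cong refl chi_add) (auto intro: K_closed_power K_closed K_numeral)
    finally show "(\<Sum>x\<in>K. chi (x\<^sup>2) * cnj (chi (y\<^sup>2))) = (\<Sum>h\<in>K. chi (h\<^sup>2) * chi (2 * h * y))" .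
  qed
  also have "\<dots> = (\<Sum>h\<in>K. chi (h\<^sup>2) * (\<Sum>y\<in>K. chi (2 * h * y)))"
    by (subst sum.swap) (simp add: sum_distrib_left)
  also have "\<dots> = (\<Sum>h\<in>K. if h = 0 then of_nat q else 0)"
    by (intro sum.cong) (auto simp: sum_chi two_neq_0 K_closed K_numeral)
  also have "\<dots> = of_nat q" by (simp add: K_closed)
  finally show ?thesis .
qed

end

section \<open>Lifting the quadratic Gauss sum to an extension field\<close>

context odd_finite_subfield
begin

lemma Fp_subset_K: "Fp \<subseteq> K"
proof
  fix x assume "x \<in> Fp"
  hence "x ^ (p ^ i) = x" for i
    by (induction i) (auto simp: subfield_pk_def power_mult)
  thus "x \<in> K" by (simp add: subfield_pk_def)
qed

lemma trace_nondegenerate: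
  assumes z: "z \<in> K" and orth: "\<And>x. x \<in> K \<Longrightarrow> trace1 p k (z * x) = 0"
  shows "z = 0"
proof (rule ccontr)
  assume "z \<noteq> 0"
  obtain x where x: "x \<in> K" "trace1 p k x \<noteq> 0" by (rule trace_nontrivial)
  have "trace1 p k (z * (x / z)) = 0" by (rule orth) (use x z in auto)
  thus False using x \<open>z \<noteq> 0\<close> by simp
qed

text \<open>The single equivalence packs two conditions: distinct members are orthogonal for the
  trace form, and each member is anisotropic.\<close>

definition orth_family :: "nat \<Rightarrow> (nat \<Rightarrow> 'a) \<Rightarrow> bool" where
  "orth_family l e \<longleftrightarrow> (\<forall>i<l. e i \<in> K) \<and>
     (\<forall>i<l. \<forall>j<l. trace1 p k (e i * e j) = 0 \<longleftrightarrow> i \<noteq> j)"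

lemma trace_orth_comb:
  assumes "orth_family l e" "\<And>i. i < l \<Longrightarrow> c i \<in> Fp" "j < l"
  shows "trace1 p k ((\<Sum>i<l. c i * e i) * e j) = c j * trace1 p k (e j * e j)"
proof -
  have "trace1 p k ((\<Sum>i<l. c i * e i) * e j) = (\<Sum>i<l. c i * trace1 p k (e i * e j))"
    using assms(2) by (simp add: sum_distrib_right trace_sum mult.assoc trace_scale)
  also have "\<dots> = (\<Sum>i<l. if i = j then c i * trace1 p k (e i * e j) else 0)"
    using assms by (intro sum.cong) (auto simp: orth_family_def)
  finally show ?thesis using assms(3) by simp
qed

text \<open>A repeated vector would be both orthogonal to itself and anisotropic. The bound is
  crude, but it suffices for a family of maximal length to exist.\<close>

lemma orth_family_bound:
  assumes "orth_family l e" shows "l \<le> q"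
proof -
  have "inj_on e {..<l}"
    using assms unfolding inj_on_def orth_family_def by (metis lessThan_iff)
  hence "card (e ` {..<l}) = l" by (simp add: card_image)
  moreover have "card (e ` {..<l}) \<le> card K"
    using assms by (intro card_mono) (auto simp: orth_family_def)
  ultimately show ?thesis by (simp add: card_K)
qed

text \<open>One step of Gram-Schmidt. The divisions are meaningful because members of the family are
  anisotropic.\<close>

lemma orth_projection:
  assumes "orth_family l e" "v \<in> K"
  obtains c where "\<And>i. i < l \<Longrightarrow> c i \<in> Fp"
    "\<And>j. j < l \<Longrightarrow> trace1 p k ((v - (\<Sum>i<l. c i * e i)) * e j) = 0"
proof
  let ?c = "\<lambda>i. trace1 p k (v * e i) / trace1 p k (e i * e i)"
  show c: "?c i \<in> Fp" if "i < l" for i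
    using assms that by (intro prime.K_closed trace_Fp K_closed) (auto simp: orth_family_def)
  show "trace1 p k ((v - (\<Sum>i<l. ?c i * e i)) * e j) = 0" if "j < l" for j
    using trace_orth_comb[OF assms(1) c that] assms(1) that
    by (simp add: left_diff_distrib trace_diff orth_family_def)
qed

lemma orth_family_extend:
  assumes e: "orth_family l e" and w: "w \<in> K" "trace1 p k (w * w) \<noteq> 0"
    "\<And>j. j < l \<Longrightarrow> trace1 p k (w * e j) = 0"
  shows "orth_family (Suc l) (e(l := w))"
proof -
  have "trace1 p k (e j * w) = 0" if "j < l" for j using w(3)[OF that] by (simp add: mult.commute)
  thus ?thesis using e w by (auto simp: orth_family_def less_Suc_eq)
qed

text \<open>A maximal orthogonal family of anisotropic vectors spans: otherwise the trace form
  would vanish identically on the orthogonal complement, by polarisation.\<close>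
lemma orth_basis:
  obtains e where "orth_family k e"
    "bij_betw (\<lambda>c. \<Sum>i<k. c i * e i) (PiE {..<k} (\<lambda>_. Fp)) K"
proof -
  let ?tr = "trace1 p k :: 'a \<Rightarrow> 'a"
  have "orth_family 0 (\<lambda>_. 0)" by (simp add: orth_family_def)
  hence "\<exists>l. (\<exists>e. orth_family l e) \<and> (\<forall>l'. (\<exists>e. orth_family l' e) \<longrightarrow> l' \<le> l)"
    by (intro ex_has_greatest_nat[of _ 0 "\<lambda>l. l" "Suc q"]) (auto dest: orth_family_bound)
  then obtain l e where e: "orth_family l e" and max: "\<And>l' e'. orth_family l' e' \<Longrightarrow> l' \<le> l"
    by blast
  let ?C = "PiE {..<l} (\<lambda>_. Fp)" and ?f = "\<lambda>c. \<Sum>i<l. c i * e i"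
  define W where "W = {w \<in> K. \<forall>j<l. ?tr (w * e j) = 0}"
  have isotropic: "?tr (w * w) = 0" if "w \<in> W" for w
    using orth_family_extend[OF e, of w] max[of "Suc l"] that by (auto simp: W_def)
  have W0: "?tr (w * w') = 0" if w: "w \<in> W" "w' \<in> W" for w w'
  proof -
    have "w + w' \<in> W" using w by (auto simp: W_def distrib_right trace_add)
    hence "?tr ((w + w') * (w + w')) = 0" by (rule isotropic)
    moreover have "(w + w') * (w + w') = w * w + w' * w' + (w * w' + w * w')" by (simp add: algebra_simps)
    ultimately have "?tr (w * w') + ?tr (w * w') = 0" using isotropic w by (simp only: trace_add) simp
    thus ?thesis using two_neq_0 by (metis mult_2 no_zero_divisors)
  qed
  have proj: "\<exists>c. (\<forall>i<l. c i \<in> Fp) \<and> v - ?f c \<in> W" if v: "v \<in> K" for v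
  proof -
    obtain c where c: "\<And>i. i < l \<Longrightarrow> c i \<in> Fp" "\<And>j. j < l \<Longrightarrow> ?tr ((v - ?f c) * e j) = 0"
      using orth_projection[OF e v] by blast
    have "?f c \<in> K" using c e Fp_subset_K by (intro K_sum K_closed) (auto simp: orth_family_def)
    with c v show ?thesis by (auto simp: W_def intro!: exI[of _ c])
  qed
  \<comment> \<open>Such a \<open>w\<close> is orthogonal to \<open>W\<close> by polarisation and to
    the span of the family by definition, hence to all of \<open>K\<close>.\<close>
  have W_eq: "w = 0" if w: "w \<in> W" for w
  proof (rule trace_nondegenerate)
    show "w \<in> K" using w by (simp add: W_def)
    fix v assume "v \<in> K"
    then obtain c where c: "\<And>i. i < l \<Longrightarrow> c i \<in> Fp" "v - ?f c \<in> W" using proj by blast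
    have "?tr (w * ?f c) = (\<Sum>i<l. c i * ?tr (w * e i))"
      using c(1) by (simp add: sum_distrib_left trace_sum mult.left_commute[of w] trace_scale)
    also have "\<dots> = 0" using w by (auto simp: W_def)
    finally have "?tr (w * ?f c) = 0" .
    moreover have "?tr (w * (v - ?f c)) = 0" using W0 w c by blast
    moreover have "w * v = w * (v - ?f c) + w * ?f c" by (simp add: algebra_simps)
    ultimately show "?tr (w * v) = 0" by (simp only: trace_add) simp
  qed
  have "inj_on ?f ?C"
  proof (rule inj_onI)
    fix c c' assume c: "c \<in> ?C" "c' \<in> ?C" "?f c = ?f c'"
    show "c = c'"
    proof (rule PiE_ext[OF c(1,2)])
      fix j assume j: "j \<in> {..<l}"
      have "c j * ?tr (e j * e j) = ?tr (?f c * e j)"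
        by (rule trace_orth_comb[OF e, symmetric]) (use c(1) j in auto)
      also have "\<dots> = ?tr (?f c' * e j)" by (simp only: c(3))
      also have "\<dots> = c' j * ?tr (e j * e j)"
        by (rule trace_orth_comb[OF e]) (use c(2) j in auto)
      finally have "c j * ?tr (e j * e j) = c' j * ?tr (e j * e j)" .
      thus "c j = c' j" using e j by (auto simp: orth_family_def)
    qed
  qed
  moreover have "?f ` ?C = K"
  proof (intro equalityI subsetI)
    fix v assume "v \<in> K"
    then obtain c where c: "\<And>i. i < l \<Longrightarrow> c i \<in> Fp" "v - ?f c \<in> W" using proj by blast
    have "v = ?f (restrict c {..<l})" using W_eq[OF c(2)] by simp
    thus "v \<in> ?f ` ?C" using c by (intro image_eqI[of _ _ "restrict c {..<l}"]) auto
  next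
    fix v assume "v \<in> ?f ` ?C"
    then obtain c where "c \<in> ?C" "v = ?f c" by blast
    thus "v \<in> K" using e Fp_subset_K by (auto intro!: K_sum K_closed simp: orth_family_def PiE_def Pi_def)
  qed
  ultimately have bij: "bij_betw ?f ?C K" by (simp add: bij_betw_def)
  hence "card ?C = q" by (simp add: bij_betw_same_card card_K)
  \<comment> \<open>Counting coordinate vectors identifies the length of the family with the degree
    of \<open>K\<close>.\<close>
  hence "p ^ l = p ^ k" using prime.card_K by (simp add: card_PiE)
  hence "l = k" using p_ge_3 by (simp add: power_inject_exp)
  thus ?thesis using that e bij by blast
qed

text \<open>The Gram matrix is \<open>M * M\<^sup>T\<close> for the matrix \<open>M\<close> of conjugates, and the Frobenius map
  permutes the columns of \<open>M\<close> cyclically, hence multiplies its determinant by \<open>(-1) ^ (k - 1)\<close>.\<close>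
lemma eta_discriminant:
  assumes e: "orth_family k e"
  shows "prime.eta (\<Prod>i<k. trace1 p k (e i * e i)) = (-1) ^ (k - 1)"
proof -
  let ?d = "\<lambda>i. trace1 p k (e i * e i)"
  define M where "M = mat k k (\<lambda>(i, j). e i ^ (p ^ j))"
  have M: "M \<in> carrier_mat k k" by (simp add: M_def)
  have "M * transpose_mat M = mat k k (\<lambda>(i, j). if i = j then ?d i else 0)"
  proof (rule eq_matI)
    fix i j assume "i < dim_row (mat k k (\<lambda>(i, j). if i = j then ?d i else 0))"
      "j < dim_col (mat k k (\<lambda>(i, j). if i = j then ?d i else 0))"
    hence ij: "i < k" "j < k" by auto
    have "(M * transpose_mat M) $$ (i, j) = trace1 p k (e i * e j)"
      using ij by (simp add: M_def scalar_prod_def trace1_def power_mult_distrib lessThan_atLeast0)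
    also have "\<dots> = (if i = j then ?d i else 0)" using e ij by (simp add: orth_family_def)
    finally show "(M * transpose_mat M) $$ (i, j) = mat k k (\<lambda>(i, j). if i = j then ?d i else 0) $$ (i, j)"
      using ij by simp
  qed (auto simp: M_def)
  moreover have "det (mat k k (\<lambda>(i, j). if i = j then ?d i else 0)) = (\<Prod>i<k. ?d i)"
    by (subst det_upper_triangular[of _ k]) 
       (auto simp: upper_triangular_def diag_mat_def prod.list_conv_set_nth lessThan_atLeast0)
  moreover have "det (M * transpose_mat M) = (det M)\<^sup>2"
    using M by (simp add: det_mult[of _ k] det_transpose[of _ k] power2_eq_square)
  ultimately have disc: "(\<Prod>i<k. ?d i) = (det M)\<^sup>2" by simp
  have "(\<Prod>i<k. ?d i) \<noteq> 0" using e by (simp add: orth_family_def)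
  hence nz: "det M \<noteq> 0" using disc by simp
  interpret frob: comm_ring_hom "\<lambda>x::'a. x ^ p"
    by unfold_locales (use frob_add[of _ _ 1] p_ge_3 in \<open>auto simp: power_mult_distrib power_0_left\<close>)
  \<comment> \<open>The index expression has the shape required by
    \<open>det_swap_initial_cols\<close> for blocks of \<open>1\<close> and \<open>k - 1\<close>
    columns. It is just \<open>j + 1\<close> modulo \<open>k\<close>.\<close>
  have "mat k k (\<lambda>(i, j). M $$ (i, if j < k - 1 then j + 1 else if j < 1 + (k - 1) then j - (k - 1) else j))
     = map_mat (\<lambda>x. x ^ p) M" (is "?M' = _")
  proof (rule eq_matI)
    fix i j assume "i < dim_row (map_mat (\<lambda>x. x ^ p) M)" "j < dim_col (map_mat (\<lambda>x. x ^ p) M)"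
    hence ij: "i < k" "j < k" by (auto simp: M_def)
    show "?M' $$ (i, j) = map_mat (\<lambda>x. x ^ p) M $$ (i, j)"
    proof (cases "j < k - 1")
      case True
      thus ?thesis using ij by (simp add: M_def power_add mult.commute flip: power_mult)
    next
      case False
      hence j: "j = k - 1" using ij by simp
      have "(e i ^ p ^ (k - 1)) ^ p = e i ^ q"
        using power_minus_mult[OF k_pos, of p] by (simp flip: power_mult)
      also have "\<dots> = e i" using e ij by (auto simp: orth_family_def intro!: K_power)
      finally show ?thesis using ij by (simp add: M_def j)
    qed
  qed (auto simp: M_def)
  with det_swap_initial_cols[OF M, of 1 "k - 1"]
  have "det M = (-1) ^ (k - 1) * det (map_mat (\<lambda>x. x ^ p) M)" using k_pos by simp
  hence "det M = (-1) ^ (k - 1) * det M ^ p" by simp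
  hence "(-1) ^ (k - 1) * det M = det M ^ p"
    by (metis (no_types, lifting) minus_one_mult_self mult.assoc mult_1)
  also have "det M ^ p = det M ^ (p - 1) * det M"
    using p_ge_3 by (intro power_minus_mult[symmetric]) simp
  \<comment> \<open>Since the discriminant is \<open>(det M)\<^sup>2\<close>, this power of
    \<open>det M\<close> is its Euler power, so it decides the quadratic character.\<close>
  finally have "det M ^ (p - 1) = (-1) ^ (k - 1)" using nz by simp
  moreover have "(\<Prod>i<k. ?d i) ^ ((p - 1) div 2) = det M ^ (p - 1)"
    using odd_p unfolding disc by (simp flip: power_mult)
  ultimately have "(\<Prod>i<k. ?d i) ^ ((p - 1) div 2) = (-1) ^ (k - 1)" by simp
  thus ?thesis using \<open>(\<Prod>i<k. ?d i) \<noteq> 0\<close> one_neq_minus_1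
    by (cases "even (k - 1)") (auto simp: prime.eta_def)
qed

lemma prime_chi: "prime.chi x = omega_pow p x"
  by (simp add: prime.chi_def)

text \<open>In orthogonal coordinates the trace of a square is a diagonal quadratic form, so the sum
  over \<open>K\<close> factors into \<open>k\<close> sums over \<open>Fp\<close>. Each contributes
  the prime Gauss sum and one sign, and the signs multiply to the character of the discriminant.
  This is the quadratic case of the Hasse-Davenport relation.\<close>

lemma gauss_lift: "gauss = (-1) ^ (k - 1) * prime.gauss ^ k"
proof -
  obtain e where e: "orth_family k e"
    and bij: "bij_betw (\<lambda>c. \<Sum>i<k. c i * e i) (PiE {..<k} (\<lambda>_. Fp)) K" by (rule orth_basis)
  let ?d = "\<lambda>i. trace1 p k (e i * e i)"
  have d: "?d i \<in> Fp" "?d i \<noteq> 0" if "i < k" for i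
    using e that by (auto simp: orth_family_def intro!: trace_Fp)
  have "gauss = (\<Sum>x\<in>K. chi (x\<^sup>2))" using sum_chi_square[of 1] by (simp add: K_closed)
  also have "\<dots> = (\<Sum>c\<in>PiE {..<k} (\<lambda>_. Fp). chi ((\<Sum>i<k. c i * e i)\<^sup>2))"
    by (rule sum.reindex_bij_betw[OF bij, symmetric])
  also have "\<dots> = (\<Sum>c\<in>PiE {..<k} (\<lambda>_. Fp). \<Prod>i<k. prime.chi (?d i * (c i)\<^sup>2))"
  proof (rule sum.cong[OF refl])
    fix c assume c: "c \<in> PiE {..<k} (\<lambda>_. Fp)"
    hence c': "\<And>i. i < k \<Longrightarrow> c i \<in> Fp" by auto
    let ?x = "\<Sum>i<k. c i * e i"
    have "trace1 p k (?x\<^sup>2) = trace1 p k (\<Sum>j<k. c j * (?x * e j))"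
      by (simp add: power2_eq_square sum_distrib_left mult_ac)
    also have "\<dots> = (\<Sum>j<k. c j * trace1 p k (?x * e j))"
      using c' by (simp add: trace_sum trace_scale)
    also have "\<dots> = (\<Sum>j<k. ?d j * (c j)\<^sup>2)"
    proof (rule sum.cong[OF refl])
      fix j assume "j \<in> {..<k}"
      hence "trace1 p k (?x * e j) = c j * ?d j" by (intro trace_orth_comb[OF e c']) auto
      thus "c j * trace1 p k (?x * e j) = ?d j * (c j)\<^sup>2"
        by (simp only:) (simp add: power2_eq_square)
    qed
    finally have "chi (?x\<^sup>2) = omega_pow p (\<Sum>j<k. ?d j * (c j)\<^sup>2)" by (simp add: chi_def)
    also have "\<dots> = (\<Prod>i<k. prime.chi (?d i * (c i)\<^sup>2))"
      unfolding prime_chi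
      using d c' by (intro omega_pow_sum) (auto intro!: prime.K_closed prime.K_closed_power)
    finally show "chi (?x\<^sup>2) = (\<Prod>i<k. prime.chi (?d i * (c i)\<^sup>2))" .
  qed
  also have "\<dots> = (\<Prod>i<k. \<Sum>y\<in>Fp. prime.chi (?d i * y\<^sup>2))"
    by (rule prod_sum_PiE[symmetric]) auto
  also have "\<dots> = (\<Prod>i<k. prime.eta (?d i) * prime.gauss)"
    using d by (intro prod.cong prime.sum_chi_square) auto
  also have "\<dots> = prime.eta (\<Prod>i<k. ?d i) * prime.gauss ^ k"
    by (subst prime.eta_prod) (use d in \<open>auto simp: prod.distrib\<close>)
  finally show ?thesis by (simp add: eta_discriminant[OF e])
qed

end

section \<open>The sign of the quadratic Gauss sum\<close>

text \<open>The Gaussian binomial coefficient with base \<open>x\<close>. The q-Pascal recursion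
  keeps it meaningful at roots of unity, where the usual quotient formula can divide by
  zero.\<close>

fun qbinom :: "'a::idom \<Rightarrow> nat \<Rightarrow> nat \<Rightarrow> 'a" where
  "qbinom x n 0 = 1"
| "qbinom x 0 (Suc k) = 0"
| "qbinom x (Suc n) (Suc k) = qbinom x n k + x ^ Suc k * qbinom x n (Suc k)"

lemma qbinom_eq_0: "k > n \<Longrightarrow> qbinom x n k = 0"
  by (induction x n k rule: qbinom.induct) auto

lemma qbinom_0_right: "qbinom x n 0 = 1" by (cases n) auto

text \<open>The ratio of neighbouring coefficients, cleared of denominators. It replaces the
  quotient formula in everything that follows about \<open>qbinom\<close>.\<close>

lemma qbinom_absorb: "(1 - x ^ Suc k) * qbinom x n (Suc k) = (1 - x ^ (n - k)) * qbinom x n k"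
proof (induction n arbitrary: k)
  case 0
  show ?case by (cases k) auto
next
  case (Suc n)
  show ?case
  proof (cases k)
    case 0
    have "(1 - x) * qbinom x n 1 = 1 - x ^ n" using Suc[of 0] by (simp add: qbinom_0_right One_nat_def)
    moreover have "(1 - x ^ Suc k) * qbinom x (Suc n) (Suc k) = (1 - x) + x * ((1 - x) * qbinom x n 1)"
      using 0 by (simp add: algebra_simps qbinom_0_right One_nat_def)
    ultimately show ?thesis using 0 by (simp only:) (simp add: algebra_simps qbinom_0_right)
  next
    case (Suc l)
    show ?thesis
    proof (cases "l < n")
      case True
      define A where "A = qbinom x n (Suc l)"
      define B where "B = qbinom x n l"
      have 1: "(1 - x ^ Suc (Suc l)) * qbinom x n (Suc (Suc l)) = (1 - x ^ (n - Suc l)) * A"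
        using Suc.IH[of "Suc l"] unfolding A_def .
      have 2: "(1 - x ^ (n - l)) * B = (1 - x ^ Suc l) * A"
        using Suc.IH[of l] unfolding A_def B_def by simp
      \<comment> \<open>Here \<open>l < n\<close> ensures that the truncated subtractions in the
        exponents are genuine.\<close>
      have 3: "x ^ Suc (Suc l) * x ^ (n - Suc l) = x ^ Suc n" "x ^ Suc l * x ^ (n - l) = x ^ Suc n"
        using True by (simp_all flip: power_add power_Suc)
      have "(1 - x ^ Suc k) * qbinom x (Suc n) (Suc k)
          = (1 - x ^ Suc (Suc l)) * A + x ^ Suc (Suc l) * ((1 - x ^ Suc (Suc l)) * qbinom x n (Suc (Suc l)))"
        by (simp add: Suc A_def algebra_simps)
      also have "\<dots> = A * (1 - x ^ Suc (Suc l) * x ^ (n - Suc l))"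
        unfolding 1 by (simp add: algebra_simps)
      also have "\<dots> = A * (1 - x ^ Suc l * x ^ (n - l))" by (simp only: 3)
      also have "\<dots> = (1 - x ^ Suc l) * A + (1 - x ^ (n - l)) * x ^ Suc l * A"
        by (simp add: algebra_simps)
      also have "\<dots> = (1 - x ^ (n - l)) * (B + x ^ Suc l * A)"
        unfolding 2[symmetric] by (simp add: algebra_simps)
      finally show ?thesis by (simp add: Suc A_def B_def)
    qed (simp add: Suc qbinom_eq_0)
  qed
qed

text \<open>The other q-Pascal rule, with the power of \<open>x\<close> attached to the other
  summand.\<close>

lemma qbinom_Suc': "qbinom x (Suc n) (Suc k) = x ^ (n - k) * qbinom x n k + qbinom x n (Suc k)"
  using qbinom_absorb[of x k n] by (simp add: algebra_simps)

lemma qbinom_lower: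
  "k \<le> Suc n \<Longrightarrow> (1 - x ^ (Suc n - k)) * qbinom x (Suc n) k = (1 - x ^ Suc n) * qbinom x n k"
proof (cases k)
  case (Suc l)
  assume "k \<le> Suc n"
  have 3: "x ^ Suc l * x ^ (n - l) = x ^ Suc n"
    using Suc \<open>k \<le> Suc n\<close> by (simp flip: power_add power_Suc)
  have "(1 - x ^ (n - l)) * qbinom x (Suc n) (Suc l)
      = (1 - x ^ (n - l)) * qbinom x n l + (1 - x ^ (n - l)) * x ^ Suc l * qbinom x n (Suc l)"
    by (simp add: algebra_simps)
  also have "\<dots> = (1 - x ^ Suc l * x ^ (n - l)) * qbinom x n (Suc l)"
    unfolding qbinom_absorb[symmetric] by (simp add: algebra_simps)
  finally show ?thesis by (simp only: 3 Suc diff_Suc_Suc)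
qed (simp add: qbinom_0_right)

text \<open>Gauss's recursion. The second Pascal rule writes the sum for \<open>n + 2\<close> as the
  sum for \<open>n + 1\<close> minus a weighted copy of it; the resulting factors
  \<open>1 - x ^ (Suc n - k)\<close> lower the upper index and leave
  \<open>1 - x ^ Suc n\<close>.\<close>

lemma qbinom_alternating_sum_step:
  "(\<Sum>k\<le>Suc (Suc n). (-1) ^ k * qbinom x (Suc (Suc n)) k)
     = (1 - x ^ Suc n) * (\<Sum>k\<le>n. (-1) ^ k * qbinom x n k)"
proof -
  let ?G = "\<Sum>k\<le>Suc n. (-1) ^ k * qbinom x (Suc n) k"
  \<comment> \<open>An index shift; the extra top term is a coefficient whose lower index exceeds
    the upper one, hence zero.\<close>
  have G: "1 + (\<Sum>k\<le>Suc n. (-1) ^ Suc k * qbinom x (Suc n) (Suc k)) = ?G"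
    using sum.atMost_Suc_shift[of "\<lambda>k. (-1) ^ k * qbinom x (Suc n) k" "Suc n"]
    by (simp add: qbinom_eq_0)
  have "(\<Sum>k\<le>Suc (Suc n). (-1) ^ k * qbinom x (Suc (Suc n)) k)
      = 1 + (\<Sum>k\<le>Suc n. (-1) ^ Suc k * qbinom x (Suc (Suc n)) (Suc k))"
    by (subst sum.atMost_Suc_shift) simp
  also have "(\<Sum>k\<le>Suc n. (-1) ^ Suc k * qbinom x (Suc (Suc n)) (Suc k))
     = (\<Sum>k\<le>Suc n. (-1) ^ Suc k * qbinom x (Suc n) (Suc k))
       - (\<Sum>k\<le>Suc n. (-1) ^ k * (x ^ (Suc n - k) * qbinom x (Suc n) k))"
    unfolding qbinom_Suc'[of x "Suc n"] sum_subtractf[symmetric]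
    by (intro sum.cong) (simp_all add: algebra_simps)
  also have "1 + \<dots> = ?G - (\<Sum>k\<le>Suc n. (-1) ^ k * (x ^ (Suc n - k) * qbinom x (Suc n) k))"
    unfolding G[symmetric] by (simp only: add_diff_eq)
  also have "\<dots> = (\<Sum>k\<le>Suc n. (-1) ^ k * ((1 - x ^ (Suc n - k)) * qbinom x (Suc n) k))"
    unfolding sum_subtractf[symmetric] by (intro sum.cong) (simp_all add: algebra_simps)
  also have "\<dots> = (\<Sum>k\<le>Suc n. (-1) ^ k * ((1 - x ^ Suc n) * qbinom x n k))"
    by (intro sum.cong refl arg_cong2[of _ _ _ _ "(*)"] qbinom_lower) auto
  also have "\<dots> = (1 - x ^ Suc n) * (\<Sum>k\<le>n. (-1) ^ k * qbinom x n k)"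
    by (simp add: qbinom_eq_0 sum_distrib_left mult_ac del: power_Suc)
  finally show ?thesis .
qed

lemma qbinom_alternating_sum:
  "(\<Sum>k\<le>2 * n. (-1) ^ k * qbinom x (2 * n) k) = (\<Prod>j<n. 1 - x ^ (2 * j + 1))"
proof (induction n)
  case (Suc n)
  have "2 * Suc n = Suc (Suc (2 * n))" by simp
  thus ?case using Suc by (simp only: qbinom_alternating_sum_step) (simp add: power_add mult.commute)
qed simp

text \<open>At a primitive \<open>N\<close>-th root of unity the ratio of neighbouring coefficients
  collapses to \<open>-1 / x ^ Suc k\<close>. Multiplying up the ratios gives a sign and a
  triangular exponent.\<close>

lemma qbinom_root_of_unity:
  assumes "x ^ N = 1" "\<And>j. 0 < j \<Longrightarrow> j < N \<Longrightarrow> x ^ j \<noteq> 1" "k < N"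
  shows "x ^ (\<Sum>i\<le>k. i) * qbinom x (N - 1) k = (-1) ^ k"
  using assms(3)
proof (induction k)
  case (Suc k)
  have "(1 - x ^ Suc k) * (x ^ Suc k * qbinom x (N - 1) (Suc k))
      = (x ^ Suc k - x ^ Suc k * x ^ (N - 1 - k)) * qbinom x (N - 1) k"
    unfolding mult.left_commute[of "1 - x ^ Suc k"] qbinom_absorb by (simp add: algebra_simps)
  also have "x ^ Suc k * x ^ (N - 1 - k) = x ^ N"
    using Suc.prems by (simp flip: power_add power_Suc)
  also have "(x ^ Suc k - x ^ N) * qbinom x (N - 1) k = (1 - x ^ Suc k) * (- qbinom x (N - 1) k)"
    by (simp add: assms(1) algebra_simps)
  finally have "(1 - x ^ Suc k) * (x ^ Suc k * qbinom x (N - 1) (Suc k))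
      = (1 - x ^ Suc k) * (- qbinom x (N - 1) k)" .
  moreover have "1 - x ^ Suc k \<noteq> 0" using assms(2)[of "Suc k"] Suc.prems by (simp del: power_Suc)
  ultimately have "x ^ Suc k * qbinom x (N - 1) (Suc k) = - qbinom x (N - 1) k"
    using mult_left_cancel by blast
  moreover have "x ^ (\<Sum>i\<le>Suc k. i) = x ^ (\<Sum>i\<le>k. i) * x ^ Suc k" by (simp add: power_add)
  ultimately show ?case using Suc by (simp add: mult.assoc power_Suc[of "-1"] del: power_Suc)
qed (simp add: qbinom_0_right)

section \<open>Evaluation of the Gauss sum over the prime field\<close>

context odd_finite_field
begin

text \<open>Completing the square backwards, with \<open>h\<close> representing one half. The
  exponents \<open>i * (i + 1)\<close> are twice triangular numbers, as needed to match
  \<open>qbinom_root_of_unity\<close>.\<close>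

lemma prime_gauss_shift:
  assumes h: "(2::'a) * of_nat h = 1"
  shows "prime.gauss = omega_pow p (of_nat (h\<^sup>2) :: 'a) * (\<Sum>i<p. omega_pow p (of_nat (i * (i + 1)) :: 'a))"
proof -
  have "prime.gauss = (\<Sum>y\<in>Fp. omega_pow p (y\<^sup>2))"
    using prime.sum_chi_square[of 1] by (simp add: prime.K_closed prime.chi_def)
  also have "\<dots> = (\<Sum>y\<in>Fp. omega_pow p ((y + of_nat h)\<^sup>2))"
    by (rule sum.reindex_bij_witness[of _ "\<lambda>y. y + of_nat h" "\<lambda>y. y - of_nat h"])
       (auto intro: prime.K_closed)
  also have "\<dots> = (\<Sum>y\<in>Fp. omega_pow p (of_nat (h\<^sup>2) :: 'a) * omega_pow p (y * (y + 1)))"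
  proof (intro sum.cong refl)
    fix y :: 'a assume y: "y \<in> Fp"
    have "(y + of_nat h)\<^sup>2 = of_nat (h\<^sup>2) + (y * y + y * (2 * of_nat h))"
      by (simp add: power2_eq_square algebra_simps)
    hence "(y + of_nat h)\<^sup>2 = of_nat (h\<^sup>2) + y * (y + 1)" unfolding h by (simp add: distrib_left)
    thus "omega_pow p ((y + of_nat h)\<^sup>2) = omega_pow p (of_nat (h\<^sup>2) :: 'a) * omega_pow p (y * (y + 1))"
      using y of_nat_Fp by (simp only:) (intro omega_pow_add prime.K_closed; assumption)
  qed
  also have "\<dots> = omega_pow p (of_nat (h\<^sup>2) :: 'a) * (\<Sum>y\<in>Fp. omega_pow p (y * (y + 1)))"
    by (simp add: sum_distrib_left)
  also have "(\<Sum>y\<in>Fp. omega_pow p (y * (y + 1))) = (\<Sum>i<p. omega_pow p (of_nat i * (of_nat i + 1) :: 'a))"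
    by (rule sum.reindex_bij_betw[OF bij_of_nat_Fp, symmetric])
  finally show ?thesis by (simp add: distrib_left)
qed

lemma prime_gauss_prod_sin:
  "prime.gauss = (\<Prod>j<(p - 1) div 2. 2 * \<i> * complex_of_real (sin (2 * pi * (2 * real j + 1) / real p)))"
proof -
  define M where "M = (p - 1) div 2"
  define z where "z = cis (2 * pi / real p)"
  have pM: "p = 2 * M + 1" using odd_p by (auto elim!: oddE simp: M_def)
  have z_pow: "z ^ i = omega_pow p (of_nat i :: 'a)" for i
    unfolding z_def Complex.DeMoivre omega_pow_of_nat by (simp add: mult_ac)
  have z_nz [simp]: "z \<noteq> 0" by (simp add: z_def)
  have zp: "z ^ p = 1" by (simp add: z_pow of_nat_p)
  have z1: "z ^ i = 1 \<longleftrightarrow> p dvd i" for i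
    using omega_pow_eq_1_iff[of "of_nat i"] by (simp add: z_pow of_nat_eq_0_iff_char_dvd CHAR_eq)
  \<comment> \<open>This base is again a primitive \<open>p\<close>-th root of unity because
    \<open>p\<close> is odd, and its triangular powers are exactly the inverses of
    \<open>z ^ (i * (i + 1))\<close>.\<close>
  define x where "x = inverse (z\<^sup>2)"
  have x_pow: "x ^ i = 1 \<longleftrightarrow> p dvd 2 * i" for i
  proof -
    have "x ^ i = inverse (z ^ (2 * i))" by (simp add: x_def power_inverse power_mult)
    thus ?thesis by (simp add: z1)
  qed
  have q: "(-1) ^ i * qbinom x (p - 1) i = omega_pow p (of_nat (i * (i + 1)) :: 'a)" if "i < p" for i
  proof -
    have "x ^ (\<Sum>j\<le>i. j) * qbinom x (p - 1) i = (-1) ^ i"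
    proof (rule qbinom_root_of_unity)
      show "x ^ j \<noteq> 1" if "0 < j" "j < p" for j
        using that prime_p p_ge_3 by (auto simp: x_pow prime_dvd_mult_iff dest: dvd_imp_le primes_dvd_imp_eq)
    qed (use that x_pow in auto)
    moreover have "x ^ (\<Sum>j\<le>i. j) * z ^ (i * (i + 1)) = 1"
    proof -
      have "i * (i + 1) = 2 * (\<Sum>j\<le>i. j)" by (induction i) auto
      hence "z ^ (i * (i + 1)) = (z\<^sup>2) ^ (\<Sum>j\<le>i. j)" by (simp only: power_mult)
      thus ?thesis by (simp add: x_def power_inverse)
    qed
    ultimately have "x ^ (\<Sum>j\<le>i. j) * qbinom x (p - 1) i = x ^ (\<Sum>j\<le>i. j) * ((-1) ^ i * z ^ (i * (i + 1)))"
      by (metis mult.left_commute mult.right_neutral)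
    hence "qbinom x (p - 1) i = (-1) ^ i * z ^ (i * (i + 1))" by (simp add: x_def)
    thus ?thesis by (simp add: z_pow del: of_nat_mult)
  qed
  have "(\<Sum>i<p. omega_pow p (of_nat (i * (i + 1)) :: 'a)) = (\<Sum>i\<le>2 * M. (-1) ^ i * qbinom x (2 * M) i)"
    using q pM by (intro sum.cong) (auto simp: lessThan_Suc_atMost)
  also have "\<dots> = (\<Prod>j<M. 1 - x ^ (2 * j + 1))" by (rule qbinom_alternating_sum)
  also have "\<dots> = (\<Prod>j<M. inverse z ^ (2 * j + 1) * (2 * \<i> * complex_of_real (sin (2 * pi * (2 * real j + 1) / real p))))"
  proof (intro prod.cong refl)
    fix j :: nat
    define t where "t = 2 * j + 1"
    have "2 * \<i> * complex_of_real (sin (2 * pi * real t / real p)) = z ^ t - inverse z ^ t"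
      unfolding z_def cis_inverse Complex.DeMoivre by (auto simp: complex_eq_iff mult_ac)
    moreover have "x ^ t = inverse z ^ t * inverse z ^ t"
      by (simp add: x_def power2_eq_square power_mult_distrib)
    hence "1 - x ^ t = inverse z ^ t * (z ^ t - inverse z ^ t)"
      by (simp add: right_diff_distrib power_inverse)
    ultimately have "1 - x ^ t = inverse z ^ t * (2 * \<i> * complex_of_real (sin (2 * pi * real t / real p)))"
      by (simp only:)
    thus "1 - x ^ (2 * j + 1) = inverse z ^ (2 * j + 1) * (2 * \<i> * complex_of_real (sin (2 * pi * (2 * real j + 1) / real p)))"
      by (simp add: t_def add.commute)
  qed
  also have "\<dots> = inverse z ^ (M\<^sup>2) * (\<Prod>j<M. 2 * \<i> * complex_of_real (sin (2 * pi * (2 * real j + 1) / real p)))"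
  proof -
    \<comment> \<open>The phases pulled out of the factors have odd exponents, which add up to a
      square.\<close>
    have "(\<Sum>j<M. 2 * j + 1) = M\<^sup>2" by (induction M) (auto simp: power2_eq_square)
    thus ?thesis by (simp only: prod.distrib flip: power_sum)
  qed
  finally have *: "(\<Sum>i<p. omega_pow p (of_nat (i * (i + 1)) :: 'a)) = 
      inverse z ^ (M\<^sup>2) * (\<Prod>j<M. 2 * \<i> * complex_of_real (sin (2 * pi * (2 * real j + 1) / real p)))" .
  have "(2::'a) * of_nat (M + 1) = of_nat p + 1" by (simp add: pM algebra_simps)
  hence h: "(2::'a) * of_nat (M + 1) = 1" by (simp add: of_nat_p)
  \<comment> \<open>The phase from completing the square, with \<open>M + 1\<close> as one half,
    cancels the collected phase modulo \<open>p\<close>.\<close>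
  have "(M + 1)\<^sup>2 = M\<^sup>2 + p" by (simp add: pM power2_eq_square algebra_simps)
  hence 1: "z ^ ((M + 1)\<^sup>2) * inverse z ^ (M\<^sup>2) = 1" by (simp only:) (simp add: power_add zp power_inverse)
  show ?thesis unfolding prime_gauss_shift[OF h] *
    unfolding z_pow[symmetric] mult.assoc[symmetric] 1 by (simp add: M_def)
qed

text \<open>The absolute value is known from \<open>gauss_mult_cnj\<close>, so only the sign of the
  real sine product remains, that is, the parity of the number of negative sines.\<close>

lemma prime_gauss_eq:
  "prime.gauss = (if p mod 4 = 3 then \<i> else 1) * complex_of_real (sqrt (real p))"
proof -
  define M where "M = (p - 1) div 2"
  have pM: "p = 2 * M + 1" using odd_p by (auto elim!: oddE simp: M_def)
  let ?s = "\<lambda>j. sin (2 * pi * (2 * real j + 1) / real p)"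
  define P where "P = (\<Prod>j<M. ?s j)"
  have g: "prime.gauss = (2 * \<i>) ^ M * complex_of_real P"
    by (simp add: prime_gauss_prod_sin M_def P_def prod.distrib)
  have "complex_of_real ((norm prime.gauss)\<^sup>2) = complex_of_real (real p)"
    unfolding complex_norm_square using prime.gauss_mult_cnj by simp
  hence "(norm prime.gauss)\<^sup>2 = real p" by (simp only: of_real_eq_iff)
  hence "norm prime.gauss = sqrt (real p)" by (metis norm_ge_zero real_sqrt_abs abs_of_nonneg)
  hence abs: "2 ^ M * \<bar>P\<bar> = sqrt (real p)" by (simp add: g norm_mult norm_power)
  \<comment> \<open>The number of indices below \<open>M\<close> whose angle exceeds
    \<open>pi\<close>; they are the last \<open>h\<close> ones.\<close>
  define h where "h = M div 2"
  have h: "2 * h \<le> M" "M \<le> 2 * h + 1" unfolding h_def by presburger+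
  have pos: "?s j > 0" if "j < M - h" for j
  proof (rule sin_gt_zero)
    have "j + h < M" using that by simp
    hence "2 * (2 * j + 1) < p" using pM h by presburger
    hence "real (2 * (2 * j + 1)) < real p" by (simp only: of_nat_less_iff)
    hence "2 * (2 * real j + 1) < real p" by simp
    hence "2 * (2 * real j + 1) / real p < 1" using p_ge_3 by (simp add: divide_simps)
    thus "2 * pi * (2 * real j + 1) / real p < pi"
      using mult_strict_left_mono[of "2 * (2 * real j + 1) / real p" 1 pi] by (simp add: mult_ac)
  qed (use p_ge_3 in auto)
  have neg: "?s j < 0" if "M - h \<le> j" "j < M" for j
  proof (rule sin_lt_zero)
    have "M \<le> j + h" using that by simp
    hence "2 * (2 * j + 1) > p" using pM h by presburger
    hence "real (2 * (2 * j + 1)) > real p" by (simp only: of_nat_less_iff)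
    hence "2 * (2 * real j + 1) > real p" by simp
    hence "2 * (2 * real j + 1) / real p > 1" using p_ge_3 by (simp add: divide_simps)
    thus "2 * pi * (2 * real j + 1) / real p > pi"
      using mult_strict_left_mono[of 1 "2 * (2 * real j + 1) / real p" pi] by (simp add: mult_ac)
    have "2 * j + 1 < p" using that pM by linarith
    hence "real (2 * j + 1) < real p" by (simp only: of_nat_less_iff)
    hence "2 * real j + 1 < real p" by simp
    hence "(2 * real j + 1) / real p < 1" using p_ge_3 by (simp add: divide_simps)
    thus "2 * pi * (2 * real j + 1) / real p < 2 * pi"
      using mult_strict_left_mono[of "(2 * real j + 1) / real p" 1 "2 * pi"] by (simp add: mult_ac)
  qed
  have "sgn P = (\<Prod>j<M. sgn (?s j))" unfolding P_def by (induction M) (auto simp: sgn_mult)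
  also have "{..<M} = {..<M - h} \<union> {M - h..<M}" by auto
  also have "(\<Prod>j\<in>\<dots>. sgn (?s j)) = (\<Prod>j<M - h. sgn (?s j)) * (\<Prod>j\<in>{M - h..<M}. sgn (?s j))"
    by (rule prod.union_disjoint) auto
  also have "(\<Prod>j<M - h. sgn (?s j)) = (\<Prod>j<M - h. 1)"
    by (rule prod.cong[OF refl]) (use pos in \<open>simp add: sgn_1_pos\<close>)
  also have "(\<Prod>j\<in>{M - h..<M}. sgn (?s j)) = (\<Prod>j\<in>{M - h..<M}. -1)"
    by (rule prod.cong[OF refl]) (use neg in \<open>simp add: sgn_1_neg\<close>)
  finally have sgn: "sgn P = (-1) ^ (M div 2)" using h by (simp add: h_def)
  have "prime.gauss = \<i> ^ M * complex_of_real (sgn P * (2 ^ M * \<bar>P\<bar>))"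
  proof -
    have "sgn P * (2 ^ M * \<bar>P\<bar>) = 2 ^ M * P" by (simp add: sgn_if)
    thus ?thesis by (simp only: g power_mult_distrib) simp
  qed
  also have "\<dots> = (\<i> ^ M * (-1) ^ (M div 2)) * complex_of_real (sqrt (real p))"
    unfolding abs sgn by simp
  also have "\<i> ^ M * (-1) ^ (M div 2) = (if p mod 4 = 3 then \<i> else 1)"
  proof (cases "even M")
    case True
    then obtain l where "M = 2 * l" by blast
    moreover from this have "p mod 4 = 1" using pM by presburger
    ultimately show ?thesis by (simp add: power_mult flip: power_mult_distrib)
  next
    case False
    then obtain l where "M = 2 * l + 1" using oddE by blast
    moreover from this have "p mod 4 = 3" using pM by presburger
    ultimately show ?thesis by (simp add: power_mult power_add flip: power_mult_distrib)
  qed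
  finally show ?thesis .
qed

end

text \<open>Identifies the constant of the statement, sign included. For \<open>p mod 4 = 3\<close>
  the exponential is the \<open>k\<close>-th power of \<open>- \<i>\<close>, and the lifting sign
  satisfies \<open>(-1) ^ k = - ((-1) ^ (k - 1))\<close>.\<close>

lemma (in odd_finite_subfield) I_const_eq: "I_const p k = - gauss / 2"
proof -
  have s: "real p powr (real k / 2) = sqrt (real p) ^ k"
  proof -
    have "real p powr (real k / 2) = (real p powr (1 / 2)) powr real k" by (simp add: powr_powr)
    thus ?thesis using p_ge_3 by (simp add: powr_half_sqrt powr_realpow)
  qed
  have m: "(-1) ^ k = - ((-1) ^ (k - 1) :: complex)" using k_pos by (cases k) auto
  show ?thesis
  proof (cases "p mod 4 = 3")
    case True
    have "exp (complex_of_real (3 * real k * pi / 2) * \<i>) = cis (3 * pi / 2) ^ k"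
      unfolding Complex.DeMoivre unfolding cis_conv_exp by (rule arg_cong[of _ _ exp]) (simp add: mult_ac)
    also have "cis (3 * pi / 2) = (-1) * \<i>"
    proof -
      have "cis (3 * pi / 2) = cis pi * cis (pi / 2)"
        unfolding cis_mult by (rule arg_cong[of _ _ cis]) simp
      thus ?thesis by simp
    qed
    finally show ?thesis using True
      by (simp only: I_const_def gauss_lift prime_gauss_eq s power_mult_distrib m) simp
  next
    case False
    thus ?thesis by (simp add: I_const_def gauss_lift prime_gauss_eq s m)
  qed
qed

section \<open>Regular bentness of Dillon-type functions\<close>

locale odd_quadratic_field = odd_finite_subfield p "2 * m" field_type m
  for p m :: nat and field_type :: "'a::{finite,field} itself"
begin

abbreviation "U \<equiv> unit_circle p m :: 'a set"

lemma card_minus_1: "p ^ (2 * m) - 1 = (q - 1) * (q + 1)"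
proof -
  have "int (p ^ (2 * m) - 1) = int ((q - 1) * (q + 1))"
    using p_ge_3 q_ge_3 by (simp add: of_nat_diff power_mult power2_eq_square algebra_simps power_add mult_2)
  thus ?thesis by (simp only: of_nat_eq_iff)
qed

text \<open>Through this factorisation the quadratic character of the large field is a function of
  \<open>x ^ (q - 1)\<close> alone.\<close>

lemma half_card_minus_1: "(p ^ (2 * m) - 1) div 2 = (q - 1) * ((q + 1) div 2)"
proof -
  have "even (q + 1)" using odd_q by simp
  then obtain j where "q + 1 = 2 * j" by (rule evenE)
  thus ?thesis unfolding card_minus_1 by simp
qed

lemma power_q_q: "((x::'a) ^ q) ^ q = x"
  using power_card[of x] by (simp add: mult_2 power_add flip: power_mult)

lemma norm_in_K: "(x::'a) ^ (q + 1) \<in> K"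
  using power_q_q[of x] by (simp add: subfield_pk_def power_add power_mult_distrib mult.commute)

lemma trace_in_K: "(x::'a) + x ^ q \<in> K"
  using power_q_q[of x] by (simp add: subfield_pk_def frob_add add.commute)

text \<open>Transitivity of the trace: the second half of the conjugates of \<open>x\<close> is the
  first half for \<open>x ^ q\<close>.\<close>

lemma trace_double: "trace1 p (2 * m) (x::'a) = trace1 p m (x + x ^ q)"
proof -
  have "(\<Sum>i<2 * m. x ^ (p ^ i)) = (\<Sum>i<m. x ^ (p ^ i)) + (\<Sum>i\<in>{m..<2 * m}. x ^ (p ^ i))"
    by (subst sum.union_disjoint[symmetric]) (auto intro!: sum.cong)
  also have "(\<Sum>i\<in>{m..<2 * m}. x ^ (p ^ i)) = (\<Sum>i<m. x ^ (p ^ (m + i)))"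
    by (rule sum.reindex_bij_witness[of _ "\<lambda>i. m + i" "\<lambda>i. i - m"]) auto
  finally show ?thesis by (simp add: trace_add) (simp add: trace1_def power_add power_mult)
qed

lemma trace_double_Fp: "trace1 p (2 * m) (x::'a) \<in> Fp"
  unfolding trace_double by (rule trace_Fp[OF trace_in_K])

lemma omega_trace: "omega_pow p (trace1 p (2 * m) x) = chi (x + x ^ q)"
  by (simp add: trace_double chi_def)

lemma U_iff: "u \<in> U \<longleftrightarrow> u ^ (q + 1) = 1" by (simp add: unit_circle_def)

lemma U_nonzero: "u \<in> U \<Longrightarrow> u \<noteq> 0" by (auto simp: U_iff power_0_left)

text \<open>The root is taken in the large field, where the Euler exponent is a multiple of
  \<open>q - 1\<close>.\<close>

lemma K_square_root:
  assumes "x \<in> K" obtains y where "x = y\<^sup>2"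
proof (cases "x = 0")
  case False
  hence "x ^ ((p ^ (2 * m) - 1) div 2) = 1"
    using assms K_iff[of x] unfolding half_card_minus_1 power_mult[of x "q - 1"] by simp
  thus ?thesis using square_if_power_half that by blast
qed (use that[of 0] in simp)

lemma U_square_root:
  assumes "u \<in> U" obtains y where "u = y\<^sup>2"
proof -
  have "(p ^ (2 * m) - 1) div 2 = (q + 1) * ((q - 1) div 2)"
  proof -
    have "even (q - 1)" using odd_q by simp
    then obtain j where "q - 1 = 2 * j" by (rule evenE)
    thus ?thesis unfolding card_minus_1 by simp
  qed
  hence "u ^ ((p ^ (2 * m) - 1) div 2) = 1" using assms U_iff by (simp only: power_mult) simp
  thus ?thesis using square_if_power_half that by blast
qed

lemma U_power_half:
  assumes "u \<in> U" shows "u ^ ((q + 1) div 2) = 1 \<or> u ^ ((q + 1) div 2) = - 1"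
proof -
  have "(u ^ ((q + 1) div 2))\<^sup>2 = u ^ ((q + 1) div 2 * 2)" by (simp add: power_mult)
  also have "(q + 1) div 2 * 2 = q + 1" by (rule dvd_div_mult_self) (use odd_q in simp)
  also have "u ^ (q + 1) = 1" using assms U_iff by blast
  finally show ?thesis by (simp add: power2_eq_1_iff)
qed

lemma range_power_q_minus_1: "x \<noteq> 0 \<Longrightarrow> x ^ (q - 1) \<in> U"
  using power_card_minus_1[of x] by (simp add: U_iff card_minus_1 flip: power_mult)

text \<open>The fibre is a coset \<open>x0 * (K - {0})\<close>, on which the trace is a linear form
  in the \<open>K\<close>-coordinate with coefficient \<open>w + w ^ q\<close>. Orthogonality
  applies after adding the missing point 0, which accounts for the \<open>- 1\<close>.\<close>

lemma sum_fibre: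
  assumes "u \<in> U"
  shows "(\<Sum>x | x \<noteq> 0 \<and> x ^ (q - 1) = u. omega_pow p (- trace1 p (2 * m) (l * x)))
       = (if l = 0 \<or> l ^ (q - 1) * u = - 1 then of_nat q else 0) - 1"
proof -
  obtain x0 where x0: "x0 \<noteq> 0" "u = x0 ^ (q - 1)"
    using roots_unity_power[of "q + 1" "q - 1" u] assms U_iff by (auto simp: card_minus_1)
  define w where "w = - l * x0"
  have "(\<Sum>x | x \<noteq> 0 \<and> x ^ (q - 1) = u. omega_pow p (- trace1 p (2 * m) (l * x)))
      = (\<Sum>y\<in>K - {0}. chi ((w + w ^ q) * y))"
  proof (rule sum.reindex_bij_witness[of _ "\<lambda>y. x0 * y" "\<lambda>x. x / x0"])
    fix x assume x: "x \<in> {x. x \<noteq> 0 \<and> x ^ (q - 1) = u}"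
    thus y: "x / x0 \<in> K - {0}" using x0 by (auto simp: K_iff power_divide)
    have "- trace1 p (2 * m) (l * x) = trace1 p (2 * m) (w * (x / x0))"
      using x0 by (simp add: w_def trace1_def frob_minus sum_negf)
    moreover have "(w * (x / x0)) + (w * (x / x0)) ^ q = (w + w ^ q) * (x / x0)"
      using y K_power[of "x / x0"] by (simp only: power_mult_distrib) (simp add: distrib_right add_divide_distrib)
    ultimately show "chi ((w + w ^ q) * (x / x0)) = omega_pow p (- trace1 p (2 * m) (l * x))"
      by (simp only: omega_trace)
  qed (use x0 in \<open>auto simp: K_iff power_mult_distrib\<close>)
  also have "\<dots> = (\<Sum>y\<in>K. chi ((w + w ^ q) * y)) - 1"
    by (simp add: sum_diff1 K_closed)
  also have "\<dots> = (if w + w ^ q = 0 then of_nat q else 0) - 1"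
    by (simp add: sum_chi trace_in_K)
  also have "w + w ^ q = 0 \<longleftrightarrow> l = 0 \<or> l ^ (q - 1) * u = - 1"
  proof -
    have "w ^ q = w ^ (q - 1) * w" by (rule power_minus_mult[symmetric]) (use q_ge_3 in linarith)
    hence "w + w ^ q = w * (1 + w ^ (q - 1))" by (simp add: distrib_left mult.commute)
    hence "w + w ^ q = 0 \<longleftrightarrow> w = 0 \<or> w ^ (q - 1) = - 1"
      by (simp only: mult_eq_0_iff add_eq_0_iff)
    moreover have "w ^ (q - 1) = l ^ (q - 1) * u"
      using odd_q by (simp add: w_def x0 power_mult_distrib)
    moreover have "w = 0 \<longleftrightarrow> l = 0" using x0 by (simp add: w_def)
    ultimately show ?thesis by (simp only:)
  qed
  finally show ?thesis .
qed

lemma walsh_eq: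
  assumes f0: "f 0 = 0" and f: "\<And>x. x \<noteq> 0 \<Longrightarrow> f x = g (x ^ (q - 1))" and g: "\<And>u. u \<in> U \<Longrightarrow> g u \<in> Fp"
  shows "walsh p (2 * m) f l = 1 + (\<Sum>u\<in>U. omega_pow p (g u) *
           ((if l = 0 \<or> l ^ (q - 1) * u = - 1 then of_nat q else 0) - 1))"
proof -
  have "walsh p (2 * m) f l = 1 + (\<Sum>x | x \<noteq> 0. omega_pow p (f x - trace1 p (2 * m) (l * x)))"
  proof -
    have "{x::'a. x \<noteq> 0} = UNIV - {0}" by auto
    moreover have "trace1 p (2 * m) (0::'a) = 0" using p_ge_3 by (simp add: trace1_def power_0_left)
    ultimately show ?thesis by (simp add: walsh_def sum_diff1 f0)
  qed
  also have "(\<Sum>x | x \<noteq> 0. omega_pow p (f x - trace1 p (2 * m) (l * x)))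
     = (\<Sum>x | x \<noteq> 0. omega_pow p (g (x ^ (q - 1))) * omega_pow p (- trace1 p (2 * m) (l * x)))"
    using f g range_power_q_minus_1 trace_double_Fp
    by (intro sum.cong refl) (simp add: omega_pow_diff omega_pow_uminus)
  also have "\<dots> = (\<Sum>u\<in>U. \<Sum>x | x \<in> {x. x \<noteq> 0} \<and> x ^ (q - 1) = u.
      omega_pow p (g (x ^ (q - 1))) * omega_pow p (- trace1 p (2 * m) (l * x)))"
    using range_power_q_minus_1 by (intro sum.group[symmetric]) auto
  also have "\<dots> = (\<Sum>u\<in>U. omega_pow p (g u) *
           ((if l = 0 \<or> l ^ (q - 1) * u = - 1 then of_nat q else 0) - 1))"
  proof (intro sum.cong refl)
    fix u assume "u \<in> U"
    from sum_fibre[OF this, of l, symmetric]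
    show "(\<Sum>x | x \<in> {x. x \<noteq> 0} \<and> x ^ (q - 1) = u.
      omega_pow p (g (x ^ (q - 1))) * omega_pow p (- trace1 p (2 * m) (l * x))) = 
      omega_pow p (g u) * ((if l = 0 \<or> l ^ (q - 1) * u = - 1 then of_nat q else 0) - 1)"
      by (simp add: sum_distrib_left)
  qed
  finally show ?thesis .
qed

text \<open>A separation bound for \<open>p\<close>-th roots of unity. As the powers of a nontrivial
  root \<open>z\<close> sum to zero, \<open>p\<close> is the sum of all \<open>1 - z ^ j\<close>
  with \<open>j < p\<close>, and each of these has norm at most \<open>j\<close> times that of
  \<open>1 - z\<close>.\<close>

lemma norm_one_minus_omega_pow_ge:
  assumes "x \<in> Fp" "x \<noteq> 0" shows "2 \<le> (real p - 1) * norm (1 - omega_pow p x)"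
proof -
  let ?z = "omega_pow p x"
  have "?z ^ p = omega_pow p (of_nat p * x)"
  proof -
    have "?z ^ j = omega_pow p (of_nat j * x)" for j
      by (induction j) (use assms in \<open>auto simp: distrib_right omega_pow_add prime.K_closed\<close>)
    thus ?thesis .
  qed
  hence zp: "?z ^ p = 1" by (simp add: of_nat_p)
  have z: "?z \<noteq> 1" using assms omega_pow_eq_1_iff by blast
  have bound: "norm (1 - ?z ^ j) \<le> real j * norm (1 - ?z)" for j
    by (subst norm_minus_commute, subst (2) norm_minus_commute)
       (use norm_power_diff[of ?z 1 j] in simp)
  have "(\<Sum>j<p. ?z ^ j) = 0" using geometric_sum[OF z, of p] zp by simp
  hence "complex_of_real (real p) = (\<Sum>j<p. 1 - ?z ^ j)" by (simp add: sum_subtractf)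
  hence "real p = norm (\<Sum>j<p. 1 - ?z ^ j)" by (metis abs_of_nat norm_of_real)
  also have "\<dots> \<le> (\<Sum>j<p. real j * norm (1 - ?z))"
    by (intro order.trans[OF norm_sum] sum_mono bound)
  also have "\<dots> = real (\<Sum>j<p. j) * norm (1 - ?z)" by (simp add: sum_distrib_right)
  also have "real (\<Sum>j<p. j) = real p * (real p - 1) / 2" by (induction p) (auto simp: field_simps)
  finally have "real p * 2 \<le> real p * ((real p - 1) * norm (1 - ?z))" by (simp add: mult_ac)
  thus ?thesis using p_ge_3 by simp
qed

text \<open>Distance 2 from 1 would force the value \<open>-1\<close>, which is no
  \<open>p\<close>-th root of unity for odd \<open>p\<close>.\<close>

lemma norm_one_minus_omega_pow_less:
  assumes "x \<in> Fp" shows "norm (1 - omega_pow p x) < 2"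
proof (rule ccontr)
  let ?z = "omega_pow p x"
  assume "\<not> ?thesis"
  hence "2\<^sup>2 \<le> (norm (1 - ?z))\<^sup>2" by (intro power_mono) auto
  moreover have n: "(Re ?z)\<^sup>2 + (Im ?z)\<^sup>2 = 1" by (metis cmod_power2 norm_omega_pow one_power2)
  moreover have "(norm (1 - ?z))\<^sup>2 = (1 - Re ?z)\<^sup>2 + (Im ?z)\<^sup>2" by (simp add: cmod_power2)
  ultimately have "Re ?z \<le> -1" by (simp add: power2_eq_square algebra_simps)
  moreover from this have "1 \<le> (Re ?z)\<^sup>2" using one_le_power[of "- Re ?z" 2] by simp
  ultimately have "Re ?z = -1" "Im ?z = 0" using n
    by (smt (verit) power2_eq_square mult_minus_left mult_cancel_left1 zero_le_power2 power2_eq_1_iff zero_eq_power2)+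
  hence "?z = -1" by (simp add: complex_eq_iff)
  hence "omega_pow p (x + x) = 1" using omega_pow_add[OF assms assms] by simp
  hence "x + x = 0" using assms omega_pow_eq_1_iff prime.K_closed by blast
  hence "x = 0" using two_neq_0 by (metis mult_2 no_zero_divisors)
  thus False using \<open>?z = -1\<close> by simp
qed

lemma regular_bent_iff:
  assumes f0: "f 0 = 0" and f: "\<And>x. x \<noteq> 0 \<Longrightarrow> f x = g (x ^ (q - 1))" and g: "\<And>u. u \<in> U \<Longrightarrow> g u \<in> Fp"
  shows "regular_bent p (2 * m) f \<longleftrightarrow> (\<Sum>u\<in>U. omega_pow p (g u)) = 1"
proof -
  define S where "S = (\<Sum>u\<in>U. omega_pow p (g u))"
  \<comment> \<open>The only point of \<open>U\<close> over which the fibre sum for \<open>l\<close>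
    picks up the term \<open>q\<close>.\<close>
  define v where "v l = - inverse (l ^ (q - 1))" for l :: 'a
  have v: "v l \<in> U" if "l \<noteq> 0" for l
    using range_power_q_minus_1[OF that] odd_q by (simp add: U_iff v_def power_inverse)
  have walsh: "walsh p (2 * m) f l = 1 + (\<Sum>u\<in>U. omega_pow p (g u) *
      ((if l = 0 \<or> l ^ (q - 1) * u = - 1 then of_nat q else 0) - 1))" for l
    by (rule walsh_eq) (fact f0 f g)+
  have W0: "walsh p (2 * m) f 0 = 1 + (of_nat q - 1) * S"
    unfolding walsh S_def mult.commute[of "of_nat q - 1"] by (simp add: sum_distrib_right)
  have W: "walsh p (2 * m) f l = 1 - S + of_nat q * omega_pow p (g (v l))" if "l \<noteq> 0" for l
  proof -
    have "l ^ (q - 1) * u = - 1 \<longleftrightarrow> u = v l" for u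
    proof -
      have "l ^ (q - 1) \<noteq> 0" using that by simp
      hence "u = - 1 / l ^ (q - 1) \<longleftrightarrow> u * l ^ (q - 1) = - 1" by (simp only: eq_divide_eq if_True not_False_eq_True)
      moreover have "v l = - 1 / l ^ (q - 1)" by (simp add: v_def divide_inverse)
      ultimately show ?thesis by (simp only: mult.commute)
    qed
    hence "walsh p (2 * m) f l = 1 + (\<Sum>u\<in>U. (if u = v l then of_nat q * omega_pow p (g u) else 0) - omega_pow p (g u))"
      unfolding walsh using that by (intro arg_cong2[of _ _ _ _ "(+)"] sum.cong) (auto simp: algebra_simps)
    thus ?thesis using v[OF that] by (simp add: sum_subtractf S_def)
  qed
  have powr: "complex_of_real (real p powr (real (2 * m) / 2)) = of_nat q"
    using p_ge_3 by (simp add: powr_realpow)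
  show ?thesis
  proof
    assume "regular_bent p (2 * m) f"
    then obtain fs where fs: "\<And>l. fs l \<in> Fp" 
      "\<And>l. walsh p (2 * m) f l = of_nat q * omega_pow p (fs l)"
      unfolding regular_bent_def powr by auto
    define A B G where "A = omega_pow p (fs 0)" and "B = omega_pow p (fs 1)" and "G = omega_pow p (g (v 1))"
    have 1: "1 + (of_nat q - 1) * S = of_nat q * A" using W0 fs(2) by (simp add: A_def)
    have 2: "1 - S + of_nat q * G = of_nat q * B" using W[of 1] fs(2) by (simp add: B_def G_def)
    \<comment> \<open>Eliminates \<open>S\<close>: add \<open>q - 1\<close> times the second Walsh
      equation to the first.\<close>
    have "of_nat q * (1 - A) = of_nat q * ((of_nat q - 1) * (B - G))"
    proof -
      have "c * (1 - A) = c * ((c - 1) * (B - G))"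
        if "1 + (c - 1) * S = c * A" "1 - S + c * G = c * B" for c
      proof -
        have "c * (1 - A) = c - (1 + (c - 1) * S)" unfolding that(1) by (simp add: algebra_simps)
        also have "\<dots> = (c - 1) * (1 - S + c * G) - (c - 1) * (c * G)" by (simp add: algebra_simps)
        also have "\<dots> = c * ((c - 1) * (B - G))" unfolding that(2) by (simp add: algebra_simps)
        finally show ?thesis .
      qed
      from this[OF 1 2] show ?thesis .
    qed
    hence 3: "1 - A = (of_nat q - 1) * (B - G)" using p_ge_3 by simp
    have gv: "g (v 1) \<in> Fp" using g v by simp
    \<comment> \<open>Distinct \<open>p\<close>-th roots of unity would give the right side of
      equation 3 norm at least 2 by the separation bound, while the left side has norm below
      2.\<close>
    have "B = G"
    proof (rule ccontr)
      assume "B \<noteq> G"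
      define t where "t = g (v 1) - fs 1"
      have t: "t \<in> Fp" using gv fs by (auto simp: t_def intro: prime.K_closed)
      have G: "G = B * omega_pow p t"
        using omega_pow_add[of "fs 1" t] t fs by (simp add: t_def G_def B_def)
      hence "t \<noteq> 0" using \<open>B \<noteq> G\<close> by auto
      have "2 \<le> (real p - 1) * norm (1 - omega_pow p t)"
        by (rule norm_one_minus_omega_pow_ge[OF t \<open>t \<noteq> 0\<close>])
      also have "\<dots> \<le> (real q - 1) * norm (1 - omega_pow p t)"
        using p_ge_3 k_pos by (intro mult_right_mono) (auto intro!: self_le_power)
      also have "norm (1 - omega_pow p t) = norm (B - G)"
      proof -
        have "B - G = B * (1 - omega_pow p t)" by (simp add: G algebra_simps)
        thus ?thesis by (simp add: norm_mult B_def)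
      qed
      also have "(real q - 1) * norm (B - G) = norm (1 - A)"
      proof -
        have "norm (of_nat q - 1 :: complex) = real q - 1"
        proof -
          have "of_nat q - 1 = complex_of_real (real q - 1)" by simp
          thus ?thesis using q_ge_3 by (simp only: norm_of_real)
        qed
        thus ?thesis unfolding 3 norm_mult by simp
      qed
      also have "\<dots> < 2" unfolding A_def using fs(1) by (rule norm_one_minus_omega_pow_less)
      finally show False by simp
    qed
    hence "S = 1" using 2 by simp
    thus "(\<Sum>u\<in>U. omega_pow p (g u)) = 1" by (simp add: S_def)
  next
    assume "(\<Sum>u\<in>U. omega_pow p (g u)) = 1"
    hence "S = 1" by (simp add: S_def)
    \<comment> \<open>The dual function. Its value at 0 is 0 because \<open>S = 1\<close> makes the
      Walsh value there equal to \<open>q\<close>.\<close>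
    let ?fs = "\<lambda>l. if l = 0 then 0 else g (v l)"
    have "\<forall>l. ?fs l \<in> Fp" using g v by (auto intro: prime.K_closed)
    moreover have "\<forall>l. walsh p (2 * m) f l = of_nat q * omega_pow p (?fs l)"
    proof
      fix l show "walsh p (2 * m) f l = of_nat q * omega_pow p (?fs l)"
        by (cases "l = 0") (simp_all only: W0 W \<open>S = 1\<close> if_True if_False not_False_eq_True omega_pow_0, simp_all)
    qed
    ultimately show "regular_bent p (2 * m) f"
      unfolding regular_bent_def powr by (intro exI[of _ ?fs] conjI)
  qed
qed

end

section \<open>Character sums over the unit circle\<close>

context odd_quadratic_field
begin

abbreviation "norm_trace_fibre \<beta> \<tau> \<equiv> {z::'a. z ^ (q + 1) = \<beta> \<and> z + z ^ q = \<tau>}"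

text \<open>Both sets consist of roots of \<open>X^2 - \<tau> X + \<beta>\<close>, so completing the
  square turns them into square roots \<open>y\<close> of the discriminant: those in
  \<open>K\<close> in one case, those with \<open>y ^ q = - y\<close> in the other.\<close>

lemma
  assumes \<tau>: "\<tau> \<in> K" and \<beta>: "\<beta> \<in> K" "\<beta> \<noteq> 0"
  shows card_norm_trace_fibre: "of_nat (card (norm_trace_fibre \<beta> \<tau>)) = 1 - eta (\<tau>\<^sup>2 - 4 * \<beta>)"
    and card_add_inverse_fibre: "of_nat (card {x \<in> K - {0}. x + \<beta> / x = \<tau>}) = 1 + eta (\<tau>\<^sup>2 - 4 * \<beta>)"
proof -
  define D where "D = \<tau>\<^sup>2 - 4 * \<beta>"
  have D: "D \<in> K" unfolding D_def using \<tau> \<beta> by (intro K_closed K_closed_power K_numeral)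
  have two_K: "x \<in> K \<longleftrightarrow> 2 * x \<in> K" for x :: 'a
    using K_closed(5)[of 2 x] K_closed(6)[of "2 * x" 2] K_numeral two_neq_0 by auto
  have complete_square: "(2 * x - \<tau>)\<^sup>2 = D \<longleftrightarrow> x * x + \<beta> = \<tau> * x" for x
  proof -
    have "(2 * x - \<tau>)\<^sup>2 - D = 4 * (x * x + \<beta> - \<tau> * x)"
      by (simp add: D_def power2_eq_square algebra_simps)
    thus ?thesis using four_neq_0 by (metis diff_eq_diff_eq diff_self mult_eq_0_iff eq_iff_diff_eq_0)
  qed
  have "card {x \<in> K - {0}. x + \<beta> / x = \<tau>} = card {y \<in> K. y\<^sup>2 = D}"
  proof (rule bij_betw_same_card[of "\<lambda>x. 2 * x - \<tau>"], rule bij_betw_byWitness[of _ "\<lambda>y. (y + \<tau>) / 2"])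
    have eq: "x + \<beta> / x = \<tau> \<longleftrightarrow> (2 * x - \<tau>)\<^sup>2 = D" if "x \<noteq> 0" for x
      using that unfolding complete_square by (simp add: field_simps)
    show "(\<lambda>x. 2 * x - \<tau>) ` {x \<in> K - {0}. x + \<beta> / x = \<tau>} \<subseteq> {y \<in> K. y\<^sup>2 = D}"
      using \<tau> eq by (auto intro!: K_closed K_numeral)
    show "(\<lambda>y. (y + \<tau>) / 2) ` {y \<in> K. y\<^sup>2 = D} \<subseteq> {x \<in> K - {0}. x + \<beta> / x = \<tau>}"
    proof safe
      fix y assume y: "y \<in> K" "D = y\<^sup>2"
      have "2 * ((y + \<tau>) / 2) = y + \<tau>"
        by (metis two_neq_0 nonzero_mult_div_cancel_left times_divide_eq_right)
      hence sq: "(2 * ((y + \<tau>) / 2) - \<tau>)\<^sup>2 = D" by (simp only: y add_diff_cancel_right')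
      hence "((y + \<tau>) / 2) * ((y + \<tau>) / 2) + \<beta> = \<tau> * ((y + \<tau>) / 2)" by (simp only: complete_square)
      hence nz: "(y + \<tau>) / 2 \<noteq> 0" using \<beta> by (metis add_0 mult_zero_right)
      show "(y + \<tau>) / 2 \<in> K" using y \<tau> by (intro K_closed K_numeral)
      show "(y + \<tau>) / 2 + \<beta> / ((y + \<tau>) / 2) = \<tau>"
        using eq[OF nz] sq by blast
      show "False" if "(y + \<tau>) / 2 = 0" using that nz by blast
    qed
  qed (use two_neq_0 in \<open>auto simp del: distrib_left_numeral\<close>)
  thus "of_nat (card {x \<in> K - {0}. x + \<beta> / x = \<tau>}) = 1 + eta (\<tau>\<^sup>2 - 4 * \<beta>)"
    using card_sqrt[OF D] by (simp add: D_def)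
  have "card (norm_trace_fibre \<beta> \<tau>) = card {y. y\<^sup>2 = D \<and> y ^ q = - y}"
  proof (rule bij_betw_same_card[of "\<lambda>x. 2 * x - \<tau>"], rule bij_betw_byWitness[of _ "\<lambda>y. (y + \<tau>) / 2"])
    have two_q: "(2::'a) ^ q = 2" by (rule K_power[OF K_numeral])
    show "(\<lambda>x. 2 * x - \<tau>) ` norm_trace_fibre \<beta> \<tau> \<subseteq> {y. y\<^sup>2 = D \<and> y ^ q = - y}"
    proof safe
      fix x :: 'a assume x: "\<beta> = x ^ (q + 1)" "\<tau> = x + x ^ q"
      show "(2 * x - (x + x ^ q))\<^sup>2 = D"
        unfolding D_def x by (simp add: power2_eq_square power_add algebra_simps)
      show "(2 * x - (x + x ^ q)) ^ q = - (2 * x - (x + x ^ q))"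
        by (simp add: frob_diff frob_add power_q_q)
    qed
    show "(\<lambda>y. (y + \<tau>) / 2) ` {y. y\<^sup>2 = D \<and> y ^ q = - y} \<subseteq> norm_trace_fibre \<beta> \<tau>"
    proof safe
      fix y :: 'a assume y: "D = y\<^sup>2" "y ^ q = - y"
      have conj: "((y + \<tau>) / 2) ^ q = (\<tau> - y) / 2"
        using y \<tau> by (simp add: power_divide frob_add two_q K_power)
      have "4 * (((y + \<tau>) / 2) * ((\<tau> - y) / 2)) = (y + \<tau>) * (\<tau> - y)"
        using two_neq_0 four_neq_0 by (simp add: field_simps)
      also have "\<dots> = \<tau>\<^sup>2 - D" by (simp add: y power2_eq_square algebra_simps)
      also have "\<dots> = 4 * \<beta>" by (simp add: D_def)
      finally have "((y + \<tau>) / 2) * ((\<tau> - y) / 2) = \<beta>" using four_neq_0 by simp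
      thus "((y + \<tau>) / 2) ^ (q + 1) = \<beta>" by (simp only: power_add conj power_one_right mult.commute)
      have "(y + \<tau>) / 2 + (\<tau> - y) / 2 = (2 * \<tau>) / 2" by (simp flip: add_divide_distrib)
      thus "(y + \<tau>) / 2 + ((y + \<tau>) / 2) ^ q = \<tau>" unfolding conj using two_neq_0 by simp
    qed
  qed (use two_neq_0 in \<open>auto simp del: distrib_left_numeral\<close>)
  also have "of_nat \<dots> = 1 - eta D"
  proof (cases "D = 0")
    case True
    hence "{y::'a. y\<^sup>2 = D \<and> y ^ q = - y} = {0}" using p_ge_3 by (auto simp: power_0_left)
    thus ?thesis using True by simp
  next
    case False
    \<comment> \<open>The discriminant always has a root in the large field, and
      \<open>d ^ q\<close> is \<open>d\<close> or \<open>- d\<close>; this sign decides which of the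
      two sets is inhabited.\<close>
    obtain d where d: "D = d\<^sup>2" using K_square_root[OF D] by blast
    have d0: "d \<noteq> 0" using d False by auto
    have "(d ^ q)\<^sup>2 = d\<^sup>2" using K_power[OF D] by (simp add: d mult.commute flip: power_mult)
    hence dq: "d ^ q = d \<or> d ^ q = - d" by (simp add: power2_eq_iff)
    have set: "{y::'a. y\<^sup>2 = D \<and> y ^ q = - y} = (if d ^ q = - d then {d, - d} else {})"
      by (auto simp: d power2_eq_iff frob_minus) (metis minus_minus)
    show ?thesis
    proof (cases "d ^ q = - d")
      case True
      hence "d \<notin> K" using neg_neq[OF d0] by (simp add: subfield_pk_def)
      have "eta D \<noteq> 1"
      proof
        assume "eta D = 1"
        then obtain y where "y \<in> K" "D = y\<^sup>2" using eta_eq_1_D[OF D] by blast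
        thus False using \<open>d \<notin> K\<close> K_closed(7)[of y] by (auto simp: d power2_eq_iff)
      qed
      thus ?thesis using set True False neg_neq[OF d0] eta_cases[of D] by auto
    next
      case False
      hence "d \<in> K" using dq by (simp add: subfield_pk_def)
      hence "eta D = 1" unfolding d using eta_square_nonzero d0 by blast
      thus ?thesis using set False by simp
    qed
  qed
  finally show "of_nat (card (norm_trace_fibre \<beta> \<tau>)) = 1 - eta (\<tau>\<^sup>2 - 4 * \<beta>)" by (simp add: D_def)
qed

text \<open>The weight \<open>F\<close> allows one regrouping to serve both the plain sum and the
  sum twisted by \<open>sgnU\<close>.\<close>

lemma sum_by_trace:
  fixes F :: "'a \<Rightarrow> complex"
  shows "(\<Sum>z | z ^ (q + 1) = \<beta>. F z * chi (z + z ^ q)) = (\<Sum>\<tau>\<in>K. (\<Sum>z\<in>norm_trace_fibre \<beta> \<tau>. F z) * chi \<tau>)"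
proof -
  have "(\<Sum>z | z ^ (q + 1) = \<beta>. F z * chi (z + z ^ q))
      = (\<Sum>\<tau>\<in>K. \<Sum>z | z \<in> {z. z ^ (q + 1) = \<beta>} \<and> z + z ^ q = \<tau>. F z * chi (z + z ^ q))"
    by (rule sum.group[symmetric]) (auto simp: trace_in_K)
  also have "\<dots> = (\<Sum>\<tau>\<in>K. (\<Sum>z\<in>norm_trace_fibre \<beta> \<tau>. F z) * chi \<tau>)"
    by (intro sum.cong refl) (auto simp: sum_distrib_right intro!: sum.cong)
  finally show ?thesis .
qed

text \<open>Each \<open>\<tau>\<close> is hit exactly twice by \<open>z + \<beta> / z\<close>, with \<open>z\<close> in \<open>K\<close> or of norm \<open>\<beta>\<close>, so the two sums
  add up to \<open>2 * (\<Sum>\<tau>\<in>K. chi \<tau>) = 0\<close>.\<close>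
lemma sum_norm_eq_kloost:
  assumes \<beta>: "\<beta> \<in> K" "\<beta> \<noteq> 0"
  shows "(\<Sum>z | z ^ (q + 1) = \<beta>. chi (z + z ^ q)) = 1 - kloost p m \<beta>"
proof -
  have inv: "x ^ (q - 2) = inverse x" if "x \<in> K" "x \<noteq> 0" for x
  proof -
    have "q - 1 = Suc (q - 2)" using q_ge_3 by simp
    hence "x ^ (q - 2) * x = 1" using that K_iff[of x] by (simp add: mult.commute)
    thus ?thesis using that by (simp add: field_simps)
  qed
  have "kloost p m \<beta> = (\<Sum>x\<in>K. chi (\<beta> * x + x ^ (q - 2)))" by (simp add: kloost_def chi_def)
  \<comment> \<open>As \<open>q - 2 > 0\<close>, the power at 0 is 0 and that term contributes 1;
    elsewhere the power is the inverse.\<close>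
  also have "\<dots> = 1 + (\<Sum>x\<in>K - {0}. chi (\<beta> * x + x ^ (q - 2)))"
    using q_ge_3 by (subst sum.remove[of _ 0]) (auto simp: K_closed power_0_left)
  also have "(\<Sum>x\<in>K - {0}. chi (\<beta> * x + x ^ (q - 2))) = (\<Sum>y\<in>K - {0}. chi (y + \<beta> / y))"
    by (rule sum.reindex_bij_witness[of _ "\<lambda>y. y / \<beta>" "\<lambda>x. \<beta> * x"])
       (use \<beta> in \<open>auto simp: inv inverse_eq_divide\<close>)
  also have "\<dots> = (\<Sum>\<tau>\<in>K. \<Sum>y | y \<in> K - {0} \<and> y + \<beta> / y = \<tau>. chi (y + \<beta> / y))"
    using \<beta> by (intro sum.group[symmetric]) auto
  also have "\<dots> = (\<Sum>\<tau>\<in>K. of_nat (card {y \<in> K - {0}. y + \<beta> / y = \<tau>}) * chi \<tau>)"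
    by (intro sum.cong refl) simp
  also have "\<dots> = (\<Sum>\<tau>\<in>K. (1 + eta (\<tau>\<^sup>2 - 4 * \<beta>)) * chi \<tau>)"
    using \<beta> by (intro sum.cong refl arg_cong2[of _ _ _ _ "(*)"] card_add_inverse_fibre)
  finally have kl: "kloost p m \<beta> = 1 + (\<Sum>\<tau>\<in>K. (1 + eta (\<tau>\<^sup>2 - 4 * \<beta>)) * chi \<tau>)" .
  have "(\<Sum>z | z ^ (q + 1) = \<beta>. chi (z + z ^ q)) = (\<Sum>\<tau>\<in>K. of_nat (card (norm_trace_fibre \<beta> \<tau>)) * chi \<tau>)"
    using sum_by_trace[of "\<lambda>_. 1" \<beta>] by simp
  also have "\<dots> = (\<Sum>\<tau>\<in>K. (1 - eta (\<tau>\<^sup>2 - 4 * \<beta>)) * chi \<tau>)"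
    using \<beta> by (intro sum.cong refl arg_cong2[of _ _ _ _ "(*)"] card_norm_trace_fibre)
  finally have "(\<Sum>z | z ^ (q + 1) = \<beta>. chi (z + z ^ q)) + (kloost p m \<beta> - 1)
      = (\<Sum>\<tau>\<in>K. (1 - eta (\<tau>\<^sup>2 - 4 * \<beta>)) * chi \<tau>) + (\<Sum>\<tau>\<in>K. (1 + eta (\<tau>\<^sup>2 - 4 * \<beta>)) * chi \<tau>)"
    by (simp add: kl)
  also have "\<dots> = (\<Sum>\<tau>\<in>K. 2 * chi (1 * \<tau>))"
    unfolding sum.distrib[symmetric] by (intro sum.cong) (simp_all add: algebra_simps)
  also have "\<dots> = 0" unfolding sum_distrib_left[symmetric] by (subst sum_chi) (auto simp: K_closed)
  finally show ?thesis by (simp add: algebra_simps add_eq_0_iff)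
qed

text \<open>The quadratic character of the group \<open>U\<close>, with values in the complex
  numbers.\<close>

definition sgnU :: "'a \<Rightarrow> complex" where
  "sgnU u = (if u ^ ((q + 1) div 2) = 1 then 1 else - 1)"

lemma sum_U_shift:
  assumes "c \<noteq> 0"
  shows "(\<Sum>u\<in>U. F u * chi (c * u + (c * u) ^ q)) = (\<Sum>z | z ^ (q + 1) = c ^ (q + 1). F (z / c) * chi (z + z ^ q))"
  by (rule sum.reindex_bij_witness[of _ "\<lambda>z. z / c" "\<lambda>u. c * u"])
     (use assms in \<open>auto simp: U_iff power_mult_distrib power_divide\<close>)

text \<open>The involution sending \<open>u\<close> to \<open>v / u\<close> with
  \<open>v = c ^ (q - 1)\<close> exchanges \<open>c * u\<close> with its conjugate, so it keeps the
  trace. It flips \<open>sgnU\<close> because \<open>v ^ ((q + 1) div 2) = - 1\<close> for a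
  nonsquare \<open>c\<close>.\<close>

lemma sum_sgnU_nonsquare:
  assumes "c \<notin> nz_squares" "c \<noteq> 0"
  shows "(\<Sum>u\<in>U. sgnU u * chi (c * u + (c * u) ^ q)) = 0"
proof -
  let ?S = "\<Sum>u\<in>U. sgnU u * chi (c * u + (c * u) ^ q)"
  define v where "v = c ^ (q - 1)"
  have v: "v \<in> U" using range_power_q_minus_1[OF assms(2)] by (simp add: v_def)
  have "v ^ ((q + 1) div 2) = c ^ ((p ^ (2 * m) - 1) div 2)"
    unfolding half_card_minus_1 v_def by (rule power_mult[symmetric])
  hence "v ^ ((q + 1) div 2) \<noteq> 1"
    using square_if_power_half[of c] assms by (auto simp: nz_squares_def)
  hence v': "v ^ ((q + 1) div 2) = - 1" using U_power_half[OF v] by blast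
  have "?S = (\<Sum>u\<in>U. - sgnU u * chi (c * u + (c * u) ^ q))"
  proof (rule sum.reindex_bij_witness[of _ "\<lambda>u. v / u" "\<lambda>u. v / u"])
    fix u assume u: "u \<in> U"
    show "v / u \<in> U" using u v by (simp add: U_iff power_divide)
    show "v / (v / u) = u" using U_nonzero[OF v] by simp
    have "c ^ (q - 1) * c = c ^ q" by (rule power_minus_mult) (use q_ge_3 in linarith)
    hence "c * v = c ^ q" by (simp add: v_def mult.commute)
    hence "c * (v / u) = c ^ q / u" by (metis times_divide_eq_right)
    also have "\<dots> = (c * u) ^ q"
      using u U_nonzero[OF u] by (simp add: U_iff field_simps power_mult_distrib power_add)
    finally have 1: "c * (v / u) = (c * u) ^ q" .
    have "sgnU (v / u) = - sgnU u"
      using U_power_half[OF u] one_neq_minus_1 by (auto simp: sgnU_def power_divide v')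
    thus "- sgnU (v / u) * chi (c * (v / u) + (c * (v / u)) ^ q) = sgnU u * chi (c * u + (c * u) ^ q)"
      unfolding 1 power_q_q by (simp add: add.commute)
  qed (use U_nonzero v U_iff in \<open>auto simp: power_divide\<close>)
  also have "\<dots> = - ?S" by (simp add: sum_negf)
  finally show ?thesis by simp
qed

text \<open>For \<open>z = w\<^sup>2\<close> of norm \<open>N\<^sup>2\<close> and trace \<open>\<tau> \<noteq> \<plusminus> 2N\<close>, exactly one of \<open>\<tau> + 2N = (w \<plusminus> w ^ q)\<^sup>2\<close> and
  \<open>\<tau> - 2N = (w \<minusplus> w ^ q)\<^sup>2\<close> is a square in \<open>K\<close>, the sign being that of \<open>w ^ (q + 1) = \<plusminus> N\<close>.\<close>
lemma eta_trace_shift: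
  assumes c: "c = d\<^sup>2" "c \<noteq> 0" and N: "N = c ^ ((q + 1) div 2)"
    and z: "z ^ (q + 1) = c ^ (q + 1)"
  defines "\<tau> \<equiv> z + z ^ q"
  shows "eta (\<tau> + 2 * N) = (if \<tau> + 2 * N = 0 then 0 else sgnU (z / c))"
    and "eta (\<tau> - 2 * N) = (if \<tau> - 2 * N = 0 then 0 else - sgnU (z / c))"
proof -
  have ev: "2 * ((q + 1) div 2) = q + 1" by (rule dvd_mult_div_cancel) (use odd_q in simp)
  have plus: "eta ((w + w ^ q)\<^sup>2) = 1" if "(w + w ^ q)\<^sup>2 \<noteq> 0" for w
    using eta_square_nonzero[OF trace_in_K] that by simp
  have minus: "eta ((w - w ^ q)\<^sup>2) = - 1" if "(w - w ^ q)\<^sup>2 \<noteq> 0" for w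
  proof -
    let ?v = "w - w ^ q"
    have nz: "?v \<noteq> 0" using that by simp
    have "?v ^ q = - ?v" by (simp add: frob_diff power_q_q)
    moreover have "?v ^ q = ?v ^ (q - 1) * ?v"
      by (rule power_minus_mult[symmetric]) (use q_ge_3 in linarith)
    ultimately have "?v ^ (q - 1) * ?v = (- 1) * ?v" by simp
    hence "?v ^ (q - 1) = - 1" using nz mult_right_cancel by blast
    moreover have "(?v\<^sup>2) ^ ((q - 1) div 2) = ?v ^ (q - 1)"
      using odd_q by (simp flip: power_mult)
    ultimately have "(?v\<^sup>2) ^ ((q - 1) div 2) \<noteq> 1" using one_neq_minus_1 by simp
    thus ?thesis using that eta_eq_1_iff eta_cases by blast
  qed
  have u: "z / c \<in> U" using z c by (simp add: U_iff power_divide)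
  \<comment> \<open>This root need not lie in \<open>U\<close>: its norm is the sign
    \<open>e\<close>, which thereby enters the norm of \<open>w\<close>.\<close>
  then obtain y where y: "z / c = y\<^sup>2" by (rule U_square_root)
  define w where "w = d * y"
  have zw: "z = w\<^sup>2" using y c by (simp add: w_def field_simps power_mult_distrib)
  define e where "e = (z / c) ^ ((q + 1) div 2)"
  have "d ^ (q + 1) = N" unfolding N c power_mult[symmetric] ev ..
  moreover have "y ^ (q + 1) = e" unfolding e_def y power_mult[symmetric] ev ..
  ultimately have "w ^ (q + 1) = N * e" by (simp only: w_def power_mult_distrib)
  hence wq: "w * w ^ q = N * e" by (simp add: power_add mult.commute)
  have \<tau>: "\<tau> = w\<^sup>2 + (w ^ q)\<^sup>2" by (simp add: \<tau>_def zw mult.commute flip: power_mult)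
  have sq: "(w + w ^ q)\<^sup>2 = \<tau> + 2 * (N * e)" "(w - w ^ q)\<^sup>2 = \<tau> - 2 * (N * e)"
    unfolding wq[symmetric] \<tau> by (simp_all add: power2_eq_square algebra_simps)
  consider "e = 1" "sgnU (z / c) = 1" | "e = - 1" "sgnU (z / c) = - 1"
    using U_power_half[OF u] one_neq_minus_1 by (auto simp: e_def sgnU_def)
  thus "eta (\<tau> + 2 * N) = (if \<tau> + 2 * N = 0 then 0 else sgnU (z / c))"
    "eta (\<tau> - 2 * N) = (if \<tau> - 2 * N = 0 then 0 else - sgnU (z / c))"
    using plus[of w] minus[of w] unfolding sq by (cases; simp)+
qed

text \<open>On each trace fibre the signs add up to a difference of two shifted values of
  \<open>eta\<close>. Summing over the trace then gives two translates of the Gauss sum.\<close>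

lemma sum_sgnU_square:
  assumes c: "c = d\<^sup>2" "c \<noteq> 0"
  defines "N \<equiv> c ^ ((q + 1) div 2)"
  shows "(\<Sum>u\<in>U. sgnU u * chi (c * u + (c * u) ^ q)) = gauss * (cnj (chi (2 * N)) - chi (2 * N))"
proof -
  have ev: "2 * ((q + 1) div 2) = q + 1" by (rule dvd_mult_div_cancel) (use odd_q in simp)
  have "N = d ^ (q + 1)" unfolding N_def c power_mult[symmetric] ev ..
  hence NK: "N \<in> K" by (simp only: norm_in_K)
  hence 2: "2 * N \<in> K" by (intro K_closed K_numeral)
  have N0: "N \<noteq> 0" using c by (simp add: N_def)
  have N2: "c ^ (q + 1) = N\<^sup>2" unfolding N_def power_mult[symmetric] mult.commute[of _ 2] ev ..
  have fibre: "(\<Sum>z\<in>norm_trace_fibre (c ^ (q + 1)) \<tau>. sgnU (z / c)) = eta (\<tau> + 2 * N) - eta (\<tau> - 2 * N)"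
    if \<tau>: "\<tau> \<in> K" for \<tau>
  proof -
    let ?X = "norm_trace_fibre (c ^ (q + 1)) \<tau>"
    have "of_nat (card ?X) = 1 - eta (\<tau>\<^sup>2 - 4 * N\<^sup>2)"
      unfolding N2 by (rule card_norm_trace_fibre) (use \<tau> NK N0 in auto)
    also have "\<tau>\<^sup>2 - 4 * N\<^sup>2 = (\<tau> + 2 * N) * (\<tau> - 2 * N)" by (simp add: power2_eq_square algebra_simps)
    also have "eta \<dots> = eta (\<tau> + 2 * N) * eta (\<tau> - 2 * N)"
      using \<tau> 2 by (intro eta_mult) auto
    finally have card: "of_nat (card ?X) = 1 - eta (\<tau> + 2 * N) * eta (\<tau> - 2 * N)" .
    have ne: "\<tau> + 2 * N \<noteq> 0 \<or> \<tau> - 2 * N \<noteq> 0"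
    proof (rule ccontr)
      assume "\<not> ?thesis"
      hence "4 * N = (\<tau> + 2 * N) - (\<tau> - 2 * N)" "\<tau> + 2 * N = 0" "\<tau> - 2 * N = 0" by auto
      thus False using four_neq_0 N0 by simp
    qed
    show ?thesis
    proof (cases "?X = {}")
      case True
      have "0 = 1 - eta (\<tau> + 2 * N) * eta (\<tau> - 2 * N)"
        using card unfolding True by (simp only: card.empty of_nat_0)
      \<comment> \<open>On an empty fibre the two character values multiply to 1, hence agree, and
        the claimed difference is zero.\<close>
      hence "eta (\<tau> + 2 * N) * eta (\<tau> - 2 * N) = 1" by simp
      hence "eta (\<tau> + 2 * N) = eta (\<tau> - 2 * N)" unfolding eta_def by (auto split: if_splits)
      thus ?thesis unfolding True by simp
    next
      case False
      have z: "eta (\<tau> + 2 * N) = (if \<tau> + 2 * N = 0 then 0 else sgnU (z / c))"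
        "eta (\<tau> - 2 * N) = (if \<tau> - 2 * N = 0 then 0 else - sgnU (z / c))" if "z \<in> ?X" for z
        using eta_trace_shift[OF c N_def[THEN meta_eq_to_obj_eq], of z] that by auto
      obtain z0 where z0: "z0 \<in> ?X" using False by blast
      \<comment> \<open>At least one of the two shifts is nonzero, and its character value
        determines the sign; so the sign is constant on the fibre.\<close>
      have "sgnU (z / c) = sgnU (z0 / c)" if "z \<in> ?X" for z
        using z[OF that] z[OF z0] ne by (auto split: if_splits)
      hence "(\<Sum>z\<in>?X. sgnU (z / c)) = of_nat (card ?X) * sgnU (z0 / c)" by simp
      also have "\<dots> = eta (\<tau> + 2 * N) - eta (\<tau> - 2 * N)"
        unfolding card z[OF z0] using ne by (auto simp: sgnU_def)
      finally show ?thesis .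
    qed
  qed
  have "(\<Sum>u\<in>U. sgnU u * chi (c * u + (c * u) ^ q)) = (\<Sum>\<tau>\<in>K. (eta (\<tau> + 2 * N) - eta (\<tau> - 2 * N)) * chi \<tau>)"
    unfolding sum_U_shift[OF c(2)] sum_by_trace by (intro sum.cong refl) (simp only: fibre)
  also have "\<dots> = (\<Sum>\<tau>\<in>K. eta (\<tau> + 2 * N) * chi \<tau>) - (\<Sum>\<tau>\<in>K. eta (\<tau> - 2 * N) * chi \<tau>)"
    by (simp add: left_diff_distrib sum_subtractf)
  also have "(\<Sum>\<tau>\<in>K. eta (\<tau> + 2 * N) * chi \<tau>) = (\<Sum>t\<in>K. eta t * chi (t - 2 * N))"
    by (rule sum.reindex_bij_witness[of _ "\<lambda>t. t - 2 * N" "\<lambda>\<tau>. \<tau> + 2 * N"]) (use 2 in auto)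
  also have "\<dots> = gauss * cnj (chi (2 * N))"
    using 2 by (simp add: gauss_def chi_diff sum_distrib_right mult.assoc)
  also have "(\<Sum>\<tau>\<in>K. eta (\<tau> - 2 * N) * chi \<tau>) = (\<Sum>t\<in>K. eta t * chi (t + 2 * N))"
    by (rule sum.reindex_bij_witness[of _ "\<lambda>t. t + 2 * N" "\<lambda>\<tau>. \<tau> - 2 * N"]) (use 2 in auto)
  also have "\<dots> = gauss * chi (2 * N)"
    using 2 by (simp add: gauss_def chi_add sum_distrib_right mult.assoc)
  finally show ?thesis by (simp add: right_diff_distrib)
qed

text \<open>The factor \<open>\<i>\<close> makes the difference of conjugate characters a real sine.
  For a square \<open>c\<close> outside \<open>C0_plus\<close> the sine is zero, so this case joins
  the nonsquare one.\<close>

lemma sum_sgnU: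
  assumes "c \<noteq> 0"
  shows "\<i> * (\<Sum>u\<in>U. sgnU u * chi (c * u + (c * u) ^ q)) = (if c \<in> C0_plus p m
      then - 4 * I_const p m * complex_of_real (sin (2 * pi * real (fp_rep p (Qf p m c)) / real p)) else 0)"
proof (cases "c \<in> nz_squares")
  case True
  then obtain d where d: "c = d\<^sup>2" by (auto simp: nz_squares_def)
  define N where "N = c ^ ((q + 1) div 2)"
  define s where "s = sin (2 * pi * real (fp_rep p (Qf p m c)) / real p)"
  have "2 * N = N + N" by simp
  hence "trace1 p m (2 * N) = Qf p m c" unfolding Qf_def N_def[symmetric] by (simp only: trace_add) simp
  hence "chi (2 * N) = cis (2 * pi * real (fp_rep p (Qf p m c)) / real p)"
    by (simp add: chi_def omega_pow_def)
  hence "cnj (chi (2 * N)) - chi (2 * N) = - 2 * \<i> * complex_of_real s"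
    by (simp add: complex_eq_iff s_def)
  hence "\<i> * (\<Sum>u\<in>U. sgnU u * chi (c * u + (c * u) ^ q)) = - 4 * I_const p m * complex_of_real s"
    unfolding sum_sgnU_square[OF d assms] N_def[symmetric] I_const_eq
    by (simp only:) (simp add: complex_eq_iff)
  moreover have "s = 0" if "c \<notin> C0_plus p m"
  proof -
    have "Qf p m c = 0" using that True by (simp add: C0_plus_def)
    thus ?thesis using fp_rep_of_nat[of 0] by (simp add: s_def)
  qed
  ultimately show ?thesis by (auto simp: s_def)
next
  case False
  thus ?thesis using sum_sgnU_nonsquare[OF False assms] by (simp add: C0_plus_def)
qed

text \<open>Since \<open>u ^ ((q + 1) div 2)\<close> is a sign, the factor coming from
  \<open>b\<close> is \<open>cis\<close> of plus or minus \<theta>: the cosine part is free of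
  \<open>sgnU\<close>, the sine part carries it.\<close>

lemma sum_U_split:
  assumes c: "c \<noteq> 0" and b: "b \<in> Fp"
  defines "\<theta> \<equiv> 2 * pi * real (fp_rep p b) / real p"
  shows "(\<Sum>u\<in>U. omega_pow p (trace1 p (2 * m) (c * u) + b * u ^ ((q + 1) div 2)))
     = (1 - kloost p m (c ^ (q + 1))) * complex_of_real (cos \<theta>) +
       complex_of_real (sin \<theta>) * (if c \<in> C0_plus p m
      then - 4 * I_const p m * complex_of_real (sin (2 * pi * real (fp_rep p (Qf p m c)) / real p)) else 0)"
proof -
  have om: "omega_pow p b = cis \<theta>" by (simp add: omega_pow_def \<theta>_def)
  have "(\<Sum>u\<in>U. omega_pow p (trace1 p (2 * m) (c * u) + b * u ^ ((q + 1) div 2)))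
    = (\<Sum>u\<in>U. chi (c * u + (c * u) ^ q) * complex_of_real (cos \<theta>)
        + complex_of_real (sin \<theta>) * (\<i> * (sgnU u * chi (c * u + (c * u) ^ q))))"
  proof (rule sum.cong[OF refl])
    fix u assume u: "u \<in> U"
    have 1: "omega_pow p (b * u ^ ((q + 1) div 2)) = complex_of_real (cos \<theta>) + \<i> * complex_of_real (sin \<theta>) * sgnU u"
      using U_power_half[OF u] one_neq_minus_1 b
      by (auto simp: sgnU_def omega_pow_uminus om complex_eq_iff)
    have 2: "b * u ^ ((q + 1) div 2) \<in> Fp"
      using U_power_half[OF u] b by (auto intro!: prime.K_closed)
    show "omega_pow p (trace1 p (2 * m) (c * u) + b * u ^ ((q + 1) div 2))
       = chi (c * u + (c * u) ^ q) * complex_of_real (cos \<theta>)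
        + complex_of_real (sin \<theta>) * (\<i> * (sgnU u * chi (c * u + (c * u) ^ q)))"
      by (simp only: omega_pow_add[OF trace_double_Fp 2] omega_trace 1) (simp add: algebra_simps)
  qed
  also have "\<dots> = (\<Sum>u\<in>U. chi (c * u + (c * u) ^ q)) * complex_of_real (cos \<theta>)
     + complex_of_real (sin \<theta>) * (\<i> * (\<Sum>u\<in>U. sgnU u * chi (c * u + (c * u) ^ q)))"
    by (simp add: sum.distrib sum_distrib_left sum_distrib_right)
  also have "(\<Sum>u\<in>U. chi (c * u + (c * u) ^ q)) = 1 - kloost p m (c ^ (q + 1))"
    using sum_U_shift[OF c, of "\<lambda>_. 1"] sum_norm_eq_kloost[OF norm_in_K, of c] c by simp
  finally show ?thesis by (simp only: sum_sgnU[OF c])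
qed

end

section \<open>Removal of the exponents \<open>r\<close> and \<open>s\<close>, and the final
  criterion\<close>

context odd_quadratic_field
begin

sublocale whole: odd_finite_subfield p "2 * m" field_type "2 * m"
  by unfold_locales simp

text \<open>For \<open>u ^ r \<noteq> 1\<close> the geometric sum over the full range
  \<open>i < (q + 1) div r\<close> vanishes; the given sum lacks the term \<open>i = 0\<close> and
  so equals the negative of that term.\<close>

lemma sum_trace_powi:
  assumes u: "u \<in> U" and r: "r > 0" "r dvd q + 1"
  shows "(\<Sum>i = 1..(q + 1) div r - 1. trace1 p (2 * m) (a * u powi (int r * int i + s)))
    = (if u ^ r = 1 then of_nat ((q + 1) div r - 1) * trace1 p (2 * m) (a * u powi s)
       else trace1 p (2 * m) (- a * u powi s))"
proof -
  let ?N = "(q + 1) div r"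
  have u0: "u \<noteq> 0" by (rule U_nonzero[OF u])
  have N: "?N > 0" "r * ?N = q + 1" using r by (auto simp: dvd_imp_le div_greater_zero_iff)
  have powi: "u powi (int r * int i + s) = (u ^ r) ^ i * u powi s" for i
  proof -
    have "u powi (int r * int i + s) = u powi (int (r * i)) * u powi s"
      using u0 by (simp add: power_int_add)
    thus ?thesis by (simp only: power_int_of_nat power_mult)
  qed
  show ?thesis
  proof (cases "u ^ r = 1")
    case True
    thus ?thesis by (simp add: powi)
  next
    case False
    have "{..<?N} = insert 0 {1..?N - 1}" using N(1) by auto
    hence "(\<Sum>i<?N. (u ^ r) ^ i) = 1 + (\<Sum>i = 1..?N - 1. (u ^ r) ^ i)" by simp
    moreover have "(u ^ r) ^ ?N = 1" unfolding power_mult[symmetric] N(2) using u U_iff by blast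
    hence "(\<Sum>i<?N. (u ^ r) ^ i) = 0" using geometric_sum[OF False, of ?N] by simp
    ultimately have "(\<Sum>i = 1..?N - 1. (u ^ r) ^ i) = - 1" by (metis add_eq_0_iff)
    moreover have "(\<Sum>i = 1..?N - 1. a * ((u ^ r) ^ i * u powi s)) = a * u powi s * (\<Sum>i = 1..?N - 1. (u ^ r) ^ i)"
      by (simp add: sum_distrib_left mult_ac)
    ultimately have "(\<Sum>i = 1..?N - 1. a * ((u ^ r) ^ i * u powi s)) = - a * u powi s" by simp
    thus ?thesis using False by (simp only: powi if_False flip: whole.trace_sum)
  qed
qed

text \<open>A Bezout inverse of \<open>s\<close> modulo \<open>q + 1\<close> inverts the power map
  on \<open>U\<close>. As \<open>q + 1\<close> is even, \<open>s\<close> is odd, so the sign in the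
  second argument of \<open>F\<close> survives the substitution.\<close>

lemma sum_U_powi:
  assumes gcd: "gcd s (int (q + 1)) = 1"
  shows "(\<Sum>u\<in>U. F (u powi s) (u ^ ((q + 1) div 2))) = (\<Sum>u\<in>U. F u (u ^ ((q + 1) div 2)))"
proof -
  obtain t w where "t * s + w * int (q + 1) = gcd s (int (q + 1))" using bezout_int by blast
  hence tw: "t * s = 1 + int (q + 1) * (- w)" using gcd by (simp add: algebra_simps)
  have powi_U: "u powi i \<in> U" if "u \<in> U" for u i
  proof -
    have "(u powi i) ^ (q + 1) = (u ^ (q + 1)) powi i"
      by (simp only: power_int_power power_int_power' mult.commute)
    thus ?thesis using that by (simp add: U_iff)
  qed
  have inv: "u powi (t * s) = u" if "u \<in> U" for u
  proof -
    have "u powi (t * s) = u powi 1 * u powi (int (q + 1) * (- w))"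
      unfolding tw using U_nonzero[OF that] by (intro power_int_add) simp
    also have "u powi (int (q + 1) * (- w)) = (u ^ (q + 1)) powi (- w)"
      by (simp only: power_int_mult power_int_of_nat)
    finally show ?thesis using that by (simp add: U_iff)
  qed
  have "odd s"
  proof
    assume "even s"
    moreover have "even (int (q + 1))" using odd_q by simp
    ultimately have "2 dvd gcd s (int (q + 1))" by (rule gcd_greatest)
    thus False unfolding gcd by simp
  qed
  have half: "(u powi s) ^ ((q + 1) div 2) = u ^ ((q + 1) div 2)" if "u \<in> U" for u
  proof -
    have "(u powi s) ^ ((q + 1) div 2) = (u ^ ((q + 1) div 2)) powi s"
      by (simp only: power_int_power power_int_power' mult.commute)
    thus ?thesis using U_power_half[OF that] \<open>odd s\<close> by (auto simp: power_int_minus_left_odd)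
  qed
  show ?thesis
    by (rule sum.reindex_bij_witness[of _ "\<lambda>u. u powi t" "\<lambda>u. u powi s"])
       (auto simp: powi_U half inv mult.commute[of s t] simp flip: power_int_mult)
qed

end

theorem theorem7:
  fixes p m r :: nat and s :: int and a b :: "'a::{finite,field}"
    and f :: "'a \<Rightarrow> 'a"
  assumes "prime p" and "odd p" and "m > 0"
    and "CARD('a) = p ^ (2 * m)"
    and "gcd s (int (p ^ m + 1)) = 1"
    and "r > 0" and "r dvd p ^ m + 1"
    and "a \<noteq> 0" and "b \<in> subfield_pk p 1" and "b \<noteq> 0"
    and "f 0 = 0"
    and "\<And>x. x \<noteq> 0 \<Longrightarrow> f x =
            (\<Sum>i = 1..(p ^ m + 1) div r - 1.
               trace1 p (2 * m) (a * x powi ((int r * int i + s) * (int (p ^ m) - 1))))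
            + b * x ^ ((p ^ (2 * m) - 1) div 2)"
  shows "regular_bent p (2 * m) f \<longleftrightarrow>
    (let \<epsilon> = (\<Sum>x\<in>{x \<in> unit_circle p m. x ^ r = 1}.
                 omega_pow p (trace1 p (2 * m) (- a * x powi s) + b * x ^ ((p ^ m + 1) div 2)))
             - (\<Sum>x\<in>{x \<in> unit_circle p m. x ^ r = 1}.
                 omega_pow p (of_nat ((p ^ m + 1) div r - 1) * trace1 p (2 * m) (a * x powi s)
                              + b * x ^ ((p ^ m + 1) div 2)))
             + 1
     in (1 - kloost p m (a ^ (p ^ m + 1))) * complex_of_real (cos (2 * pi * real (fp_rep p b) / real p))
        = (if - a \<in> C0_plus p m
           then 4 * I_const p m * complex_of_real (sin (2 * pi * real (fp_rep p b) / real p))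
                  * complex_of_real (sin (2 * pi * real (fp_rep p (Qf p m (- a))) / real p)) + \<epsilon>
           else \<epsilon>))"
proof -
  interpret odd_quadratic_field p m "TYPE('a)"
    by unfold_locales (use assms in auto)
  let ?h = "(q + 1) div 2" and ?N = "(q + 1) div r" and ?Tr = "trace1 p (2 * m) :: 'a \<Rightarrow> 'a"
  \<comment> \<open>The function through which \<open>f\<close> factors on nonzero arguments via
    \<open>x ^ (q - 1)\<close>.\<close>
  define g where "g u = (\<Sum>i = 1..?N - 1. ?Tr (a * u powi (int r * int i + s))) + b * u ^ ?h" for u
  define h where "h u = omega_pow p (?Tr (- a * u powi s) + b * u ^ ?h)" for u
  define h' where "h' u = omega_pow p (of_nat (?N - 1) * ?Tr (a * u powi s) + b * u ^ ?h)" for u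
  define V where "V = {x \<in> U. x ^ r = 1}"
  define \<epsilon> where "\<epsilon> = (\<Sum>u\<in>V. h u) - (\<Sum>u\<in>V. h' u) + 1"
  define T where "T = (\<Sum>u\<in>U. h u)"
  have f: "f x = g (x ^ (q - 1))" if "x \<noteq> 0" for x
  proof -
    have 1: "int q - 1 = int (q - 1)" using q_ge_3 by simp
    have "x powi ((int r * int i + s) * (int q - 1)) = (x ^ (q - 1)) powi (int r * int i + s)" for i
      unfolding 1 mult.commute[of _ "int (q - 1)"] power_int_mult power_int_of_nat ..
    moreover have "x ^ ((p ^ (2 * m) - 1) div 2) = (x ^ (q - 1)) ^ ?h"
      unfolding half_card_minus_1 by (rule power_mult)
    ultimately show ?thesis unfolding assms(12)[OF that] g_def by (simp only:)
  qed
  have g: "g u \<in> Fp" if "u \<in> U" for u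
  proof -
    have "b * u ^ ?h \<in> Fp" using U_power_half[OF that] assms(9) by (auto intro!: prime.K_closed)
    thus ?thesis unfolding g_def by (rule prime.K_closed(3)[OF prime.K_sum[OF trace_double_Fp]])
  qed
  have "(\<Sum>u\<in>U. omega_pow p (g u)) = (\<Sum>u\<in>U. if u ^ r = 1 then h' u else h u)"
    by (intro sum.cong refl)
       (simp add: g_def sum_trace_powi[OF _ assms(6,7)] h_def h'_def del: mult_minus_left)
  also have "\<dots> = (\<Sum>u\<in>V. h' u) + (\<Sum>u\<in>{u \<in> U. u ^ r \<noteq> 1}. h u)"
    by (simp add: sum.If_cases V_def Int_def conj_commute Collect_neg_eq[symmetric])
  also have "(\<Sum>u\<in>{u \<in> U. u ^ r \<noteq> 1}. h u) = T - (\<Sum>u\<in>V. h u)"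
  proof -
    have "U = V \<union> {u \<in> U. u ^ r \<noteq> 1}" "V \<inter> {u \<in> U. u ^ r \<noteq> 1} = {}" by (auto simp: V_def)
    hence "T = (\<Sum>u\<in>V. h u) + (\<Sum>u\<in>{u \<in> U. u ^ r \<noteq> 1}. h u)"
      unfolding T_def by (metis (no_types, lifting) finite sum.union_disjoint)
    thus ?thesis by simp
  qed
  \<comment> \<open>The summand 1 inside \<epsilon> is what turns the condition that the sum be 1
    into \<open>T = \<epsilon>\<close>.\<close>
  finally have S: "(\<Sum>u\<in>U. omega_pow p (g u)) = T - \<epsilon> + 1" by (simp add: \<epsilon>_def)
  have "T = (\<Sum>u\<in>U. omega_pow p (?Tr (- a * u) + b * u ^ ?h))"
    unfolding T_def h_def
    by (rule sum_U_powi[OF assms(5), of "\<lambda>x y. omega_pow p (?Tr (- a * x) + b * y)"])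
  also have "\<dots> = (1 - kloost p m ((- a) ^ (q + 1))) * complex_of_real (cos (2 * pi * real (fp_rep p b) / real p)) +
       complex_of_real (sin (2 * pi * real (fp_rep p b) / real p)) * (if - a \<in> C0_plus p m
      then - 4 * I_const p m * complex_of_real (sin (2 * pi * real (fp_rep p (Qf p m (- a))) / real p)) else 0)"
    by (rule sum_U_split) (use assms in auto)
  also have "(- a) ^ (q + 1) = a ^ (q + 1)"
    by (rule power_minus_even) (use odd_q in simp)
  finally have T_eq: "T = (1 - kloost p m (a ^ (q + 1))) * complex_of_real (cos (2 * pi * real (fp_rep p b) / real p)) +
       complex_of_real (sin (2 * pi * real (fp_rep p b) / real p)) * (if - a \<in> C0_plus p m
      then - 4 * I_const p m * complex_of_real (sin (2 * pi * real (fp_rep p (Qf p m (- a))) / real p)) else 0)" .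
  \<comment> \<open>Pure algebra over abstract atoms: the sine term changes sides, and with it its
    sign.\<close>
  have rearrange: "t = e \<longleftrightarrow> X = (if P then 4 * i * sn * y + e else e)"
    if "t = X + sn * (if P then - 4 * i * y else 0)" for t e X i sn y :: complex and P
  proof -
    have "X = t + (if P then 4 * i * sn * y else 0)" using that by (simp add: algebra_simps)
    thus ?thesis by (simp add: add.commute)
  qed
  have T: "T = \<epsilon> \<longleftrightarrow> (1 - kloost p m (a ^ (q + 1))) * complex_of_real (cos (2 * pi * real (fp_rep p b) / real p))
        = (if - a \<in> C0_plus p m
           then 4 * I_const p m * complex_of_real (sin (2 * pi * real (fp_rep p b) / real p))
                  * complex_of_real (sin (2 * pi * real (fp_rep p (Qf p m (- a))) / real p)) + \<epsilon>
           else \<epsilon>)"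
    by (rule rearrange[OF T_eq])
  have "regular_bent p (2 * m) f \<longleftrightarrow> T - \<epsilon> + 1 = 1"
    unfolding S[symmetric] by (rule regular_bent_iff) (use f g assms(11) in auto)
  also have "\<dots> \<longleftrightarrow> T = \<epsilon>" by simp
  also note T
  finally show ?thesis unfolding Let_def \<epsilon>_def V_def h_def h'_def .
qed

end
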